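(* Let $q\in\mathbb{R}$ and consider the ordinary differential equation $$h\,(h'^2+h^2)^{\frac{q-2}{2}}(h''+h)=1\quad\text{on }\mathbb{S}^1. \qquad ( * )$$ (a) When $0<q<1$, equation $( * )$ has exactly two solutions (up to rotation), of which one is the constant solution and the other is a positive smooth non-constant solution. (b) When $1\le q\le 4$, equation $( * )$ has only one solution, which is just the constant solution.
   Context: The unit circle $\mathbb{S}^1$ is parametrized by arc length $\theta\in[0,2\pi]$, so functions on $\mathbb{S}^1$ are $2\pi$-periodic functions of $\theta$; the superscript $'$ denotes $\frac{d}{d\theta}$. A solution is a positive $C^2$ function $h:\mathbb{S}^1\to(0,\infty)$ satisfying the equation at every point (such a solution is automatically smooth). Two solutions are identified up to rotation if $h_2(\theta)=h_1(\theta+c)$ for some constant $c$. The constant solution is $h\equiv 1$. *)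

theory Defs
  imports "HOL-Analysis.Analysis"
begin

text \<open>Functions on the unit circle are modelled as functions of the arc length
  \<open>\<theta> :: real\<close> that are periodic with period \<open>2\<pi>\<close>.\<close>

definition C2 :: "(real \<Rightarrow> real) \<Rightarrow> bool" where
  "C2 h \<longleftrightarrow> h differentiable_on UNIV \<and> deriv h differentiable_on UNIV
     \<and> continuous_on UNIV (deriv (deriv h))"

definition smooth :: "(real \<Rightarrow> real) \<Rightarrow> bool" where
  "smooth h \<longleftrightarrow> (\<forall>n. (deriv ^^ n) h differentiable_on UNIV)"

text \<open>The base of the real power is positive because \<open>h\<close> is, so \<open>powr\<close> is the ordinary
  real power here.\<close>

definition solutions :: "real \<Rightarrow> (real \<Rightarrow> real) set" where
  "solutions q = {h. (\<forall>\<theta>. h (\<theta> + 2 * pi) = h \<theta>) \<and> (\<forall>\<theta>. 0 < h \<theta>) \<and> C2 h \<and>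
     (\<forall>\<theta>. h \<theta> * ((deriv h \<theta>)\<^sup>2 + (h \<theta>)\<^sup>2) powr ((q - 2) / 2)
            * (deriv (deriv h) \<theta> + h \<theta>) = 1)}"

definition rotation :: "((real \<Rightarrow> real) \<times> (real \<Rightarrow> real)) set" where
  "rotation = {(h\<^sub>1, h\<^sub>2). \<exists>c. \<forall>\<theta>. h\<^sub>2 \<theta> = h\<^sub>1 (\<theta> + c)}"

lemma equiv_rotation: "equiv UNIV rotation"
proof (rule equivI)
  show "rotation \<subseteq> UNIV \<times> UNIV" by simp
  show "refl rotation"
    unfolding refl_on_def rotation_def by (auto intro: exI[of _ 0])
  show "sym rotation"
  proof (rule symI)
    fix f g assume "(f, g) \<in> rotation"
    then obtain c where "\<forall>\<theta>. g \<theta> = f (\<theta> + c)" by (auto simp: rotation_def)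
    then have "\<forall>\<theta>. f \<theta> = g (\<theta> + - c)" by simp
    then show "(g, f) \<in> rotation" unfolding rotation_def by blast
  qed
  show "trans rotation"
  proof (rule transI)
    fix f g k assume "(f, g) \<in> rotation" "(g, k) \<in> rotation"
    then obtain c d where "\<forall>\<theta>. g \<theta> = f (\<theta> + c)" "\<forall>\<theta>. k \<theta> = g (\<theta> + d)"
      unfolding rotation_def by blast
    then have "\<forall>\<theta>. k \<theta> = f (\<theta> + (d + c))" by (simp add: add.assoc)
    then show "(f, k) \<in> rotation" unfolding rotation_def by blast
  qed
qed

end

theory Submission
  imports Defs "HOL-Real_Asymp.Real_Asymp"
begin

text \<open>
  Put \<open>r\<^sup>2 = h\<^sup>2 + h'\<^sup>2\<close>, \<open>u = r\<^sup>q\<close>, \<open>h = r cos \<phi>\<close> and \<open>h' = r sin \<phi>\<close>. The equation becomes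
  \<open>u' = q tan \<phi>\<close>, \<open>\<phi>' = 1/u - 1\<close>, with the constant of motion
  \<open>C = cos \<phi> exp (- (u - ln u - 1) / q)\<close>. If \<open>\<gamma>(u) = \<plusminus> sqrt (1 - exp (- 2 (u - ln u - 1) / q))\<close>, with
  the sign of \<open>u - 1\<close>, then \<open>(sin \<phi>, cos \<phi> \<gamma>(u))\<close> runs through the circle of radius
  \<open>S = sqrt (1 - C\<^sup>2)\<close> with angular velocity \<open>1 / \<rho>(u)\<close>, where \<open>\<rho>(u) = u \<gamma>(u) / (u - 1)\<close>. So the
  period of an orbit is a nonsingular integral of \<open>\<rho>\<close> over the angle. Adding the contributions of
  opposite angles leaves \<open>\<rho>(u) + \<rho>(v)\<close> with \<open>u - ln u = v - ln v\<close>, a function of \<open>s = (u - v) / 2\<close>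
  alone, namely \<open>2 \<gamma> / A'(s)\<close> with \<open>A(s) = s coth s - 1 + ln (sinh s / s)\<close>. It lies strictly
  between 1 and 2 if \<open>1 \<le> q \<le> 4\<close>, and decreases from \<open>2 / sqrt q\<close> to 1 if \<open>q \<le> 1\<close>. Hence the period
  exceeds \<open>\<pi>\<close>, so that a nonconstant solution must have period exactly \<open>2\<pi>\<close>; this happens for
  no \<open>S\<close> if \<open>1 \<le> q \<le> 4\<close> and for precisely one if \<open>0 < q < 1\<close>.
\<close>

section \<open>The symmetrized potential\<close>

text \<open>At \<open>s = 0\<close> division by zero gives junk values (\<open>s_coth 0 = 0\<close> instead of 1). The relations
  \<open>s c' = c - p\<close>, \<open>s p' = 2 p (1 - c)\<close>, \<open>s\<^sup>2 = c\<^sup>2 - p\<close> for \<open>c = s_coth s\<close>, \<open>p = s_csch_sq s\<close> turn the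
  estimates on the potential into polynomial inequalities.\<close>


definition s_coth :: "real \<Rightarrow> real" where "s_coth s = s * cosh s / sinh s"
definition s_csch_sq :: "real \<Rightarrow> real" where "s_csch_sq s = (s / sinh s)\<^sup>2"
text \<open>Since \<open>s_csch_sq s\<close> is a square, the last term equals
  \<open>ln (sinh s / s)\<close> for positive \<open>s\<close>: this is \<open>A(s)\<close>, written
  with \<open>s_coth\<close> and \<open>s_csch_sq\<close> only.\<close>

definition pot :: "real \<Rightarrow> real" where "pot s = s_coth s - 1 - ln (s_csch_sq s) / 2"
definition dpot :: "real \<Rightarrow> real" where "dpot s = (2 * s_coth s - 1 - s_csch_sq s) / s"

section \<open>Bounds, derivatives and limits at zero of the hyperbolic expressions\<close>

lemma sinh_gt_self: "0 < s \<Longrightarrow> s < sinh (s::real)"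
proof -
  assume s: "0 < s"
  have "(\<lambda>x. sinh x - x) 0 < (\<lambda>x. sinh x - x) s"
  proof (rule DERIV_pos_imp_increasing_open[OF s])
    fix x :: real assume x: "0 < x" "x < s"
    have "cosh x > 1" using x cosh_real_strict_mono[of 0 x] by simp
    then show "\<exists>y. ((\<lambda>x. sinh x - x) has_real_derivative y) (at x) \<and> 0 < y"
      by (intro exI[of _ "cosh x - 1"]) (auto intro!: derivative_eq_intros)
  qed (intro continuous_intros)
  then show ?thesis by simp
qed

lemma sinh_lt_mult_cosh: "0 < s \<Longrightarrow> sinh s < s * cosh (s::real)"
proof -
  assume s: "0 < s"
  have "(\<lambda>x. x * cosh x - sinh x) 0 < (\<lambda>x. x * cosh x - sinh x) s"
  proof (rule DERIV_pos_imp_increasing_open[OF s])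
    fix x :: real assume x: "0 < x" "x < s"
    then show "\<exists>y. ((\<lambda>x. x * cosh x - sinh x) has_real_derivative y) (at x) \<and> 0 < y"
      by (intro exI[of _ "x * sinh x"]) (auto intro!: derivative_eq_intros)
  qed (intro continuous_intros)
  then show ?thesis by simp
qed

lemma s_coth_gt_1: "0 < s \<Longrightarrow> 1 < s_coth s"
  using sinh_lt_mult_cosh[of s] by (simp add: s_coth_def field_simps)

lemma s_csch_sq_bounds: assumes "0 < s" shows "0 < s_csch_sq s" "s_csch_sq s < 1"
proof -
  have "0 < sinh s" "s < sinh s" using assms sinh_gt_self by auto
  then have "0 < s / sinh s" "s / sinh s < 1" using assms by auto
  then show "0 < s_csch_sq s" "s_csch_sq s < 1" by (auto simp: s_csch_sq_def power_less_one_iff)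
qed

lemma s_coth_s_csch_sq: "0 < s \<Longrightarrow> s\<^sup>2 = (s_coth s)\<^sup>2 - s_csch_sq s"
  using cosh_square_eq[of s] by (simp add: s_coth_def s_csch_sq_def field_simps)

lemma s_coth_deriv:
  "0 < s \<Longrightarrow> (s_coth has_real_derivative (s_coth s - s_csch_sq s) / s) (at s)"
  unfolding s_coth_def[abs_def] s_csch_sq_def
  apply (auto intro!: derivative_eq_intros)
  using cosh_square_eq[of s]
  apply (simp add: field_simps power2_eq_square power3_eq_cube)
  done

lemma s_csch_sq_deriv:
  "0 < s \<Longrightarrow> (s_csch_sq has_real_derivative (2 * s_csch_sq s * (1 - s_coth s)) / s) (at s)"
  unfolding s_coth_def s_csch_sq_def[abs_def]
  apply (auto intro!: derivative_eq_intros)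
  apply (simp add: field_simps power2_eq_square power3_eq_cube)
  done

lemma pot_deriv: assumes "0 < s" shows "(pot has_real_derivative dpot s) (at s)"
proof (rule DERIV_cong)
  show "(pot has_real_derivative (s_coth s - s_csch_sq s) / s - 0 - (2 * s_csch_sq s * (1 - s_coth s) / s) * (inverse (s_csch_sq s)) / 2) (at s)"
    unfolding pot_def[abs_def] using s_csch_sq_bounds[OF assms]
    by (intro DERIV_diff DERIV_cdivide DERIV_const s_coth_deriv[OF assms]
        DERIV_cong[OF DERIV_chain2[OF DERIV_ln s_csch_sq_deriv[OF assms]]]) auto
  show "(s_coth s - s_csch_sq s) / s - 0 - (2 * s_csch_sq s * (1 - s_coth s) / s) * (inverse (s_csch_sq s)) / 2 = dpot s"
    using assms s_csch_sq_bounds[OF assms] by (simp add: dpot_def divide_simps) (simp add: algebra_simps)?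
qed

lemma dpot_deriv:
  "0 < s \<Longrightarrow> (dpot has_real_derivative (1 - 3 * s_csch_sq s + 2 * s_csch_sq s * s_coth s) / s\<^sup>2) (at s)"
  unfolding dpot_def[abs_def]
  apply (auto intro!: derivative_eq_intros s_coth_deriv s_csch_sq_deriv s_csch_sq_bounds)
  apply (simp add: field_simps power2_eq_square)
  done

lemma s_coth_at_0: "(s_coth \<longlongrightarrow> 1) (at_right 0)"
  unfolding s_coth_def[abs_def] sinh_field_def cosh_field_def by real_asymp
lemma s_csch_sq_at_0: "(s_csch_sq \<longlongrightarrow> 1) (at_right 0)"
  unfolding s_csch_sq_def[abs_def] sinh_field_def by real_asymp
lemma dpot_at_0: "(dpot \<longlongrightarrow> 0) (at_right 0)"
  unfolding dpot_def[abs_def] s_coth_def s_csch_sq_def sinh_field_def cosh_field_def by real_asymp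

lemma pot_at_0: "(pot \<longlongrightarrow> 0) (at_right 0)"
proof -
  have "(pot \<longlongrightarrow> 1 - 1 - ln 1 / 2) (at_right 0)"
    unfolding pot_def[abs_def] by (intro tendsto_intros s_coth_at_0 s_csch_sq_at_0) auto
  then show ?thesis by simp
qed

text \<open>The limit takes the place of the value at \<open>0\<close>, which is junk for the
  functions to which this is applied.\<close>

lemma limit_less_of_DERIV_pos:
  fixes f :: "real \<Rightarrow> real"
  assumes "0 < s" "(f \<longlongrightarrow> L) (at_right 0)"
    and "\<And>x. 0 < x \<Longrightarrow> \<exists>y. (f has_real_derivative y) (at x) \<and> 0 < y"
  shows "L < f s"
proof -
  have mono: "f x < f y" if "0 < x" "x < y" for x y
    using that by (intro DERIV_pos_imp_increasing[OF that(2)] assms(3)) auto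
  \<comment> \<open>The limit gives only a weak inequality; passing through \<open>s / 2\<close>
    restores strictness.\<close>
  have "L \<le> f (s / 2)"
  proof (rule tendsto_upperbound[OF assms(2)])
    show "\<forall>\<^sub>F x in at_right 0. f x \<le> f (s / 2)"
      using assms(1) mono[of _ "s/2"]
      by (intro eventually_at_rightI[of 0 "s/2"]) (auto intro: less_imp_le)
  qed auto
  also have "\<dots> < f s" using assms(1) by (intro mono) auto
  finally show ?thesis .
qed

section \<open>Inequalities for the potential and its derivative\<close>

lemma dpot_pos: "0 < s \<Longrightarrow> 0 < dpot s"
  using s_coth_gt_1[of s] s_csch_sq_bounds[of s] by (simp add: dpot_def)

lemma pot_pos: "0 < s \<Longrightarrow> 0 < pot s"
  by (rule limit_less_of_DERIV_pos[OF _ pot_at_0]) (auto intro!: pot_deriv dpot_pos exI)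

text \<open>Equality holds in the limit at \<open>0\<close>, and the derivative has the sign of
  \<open>4 c - 2 p (1 + c)\<close>, which is positive because \<open>p < 1 < c\<close>. The next two
  estimates rest on this sign condition.\<close>

lemma s_coth_s_csch_sq_gt_5: "0 < s \<Longrightarrow> 5 < 4 * s_coth s + s_csch_sq s"
proof (rule limit_less_of_DERIV_pos[where f = "\<lambda>s. 4 * s_coth s + s_csch_sq s" ])
  show "((\<lambda>s. 4 * s_coth s + s_csch_sq s) \<longlongrightarrow> 5) (at_right 0)"
    by (rule tendsto_eq_intros s_coth_at_0 s_csch_sq_at_0 | simp)+
  fix x :: real assume x: "0 < x"
  define c p where "c = s_coth x" and "p = s_csch_sq x"
  have cp: "1 < c" "0 < p" "p < 1" using x s_coth_gt_1 s_csch_sq_bounds by (auto simp: c_def p_def)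
  have "p * (1 + c) < 1 * (1 + c)" using cp by (intro mult_strict_right_mono) auto
  then have "0 < (4 * (c - p) + 2 * p * (1 - c)) / x"
    using x cp by (intro divide_pos_pos) (auto simp: algebra_simps)
  moreover have "((\<lambda>s. 4 * s_coth s + s_csch_sq s) has_real_derivative (4 * (c - p) + 2 * p * (1 - c)) / x) (at x)"
    using x by (auto intro!: derivative_eq_intros s_coth_deriv s_csch_sq_deriv simp: c_def p_def divide_simps)
  ultimately show "\<exists>y. ((\<lambda>s. 4 * s_coth s + s_csch_sq s) has_real_derivative y) (at x) \<and> 0 < y"
    by blast
qed

text \<open>After multiplication by \<open>s\<^sup>2 = c\<^sup>2 - p\<close> the claim is polynomial
  in \<open>c\<close> and \<open>p\<close>; replacing \<open>4 c\<close> by its lower bound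
  \<open>5 - p\<close> leaves \<open>2 (p - 1) (p + 2) < 0\<close>. It makes the logarithm in
  \<open>dpot_upper\<close> meaningful.\<close>

lemma dpot_sq_less_4: "0 < s \<Longrightarrow> (dpot s)\<^sup>2 < 4"
proof -
  assume s: "0 < s"
  define c p where "c = s_coth s" and "p = s_csch_sq s"
  have cp: "1 < c" "0 < p" "p < 1" "s\<^sup>2 = c\<^sup>2 - p" "5 < 4 * c + p"
    using s s_coth_gt_1 s_csch_sq_bounds s_coth_s_csch_sq s_coth_s_csch_sq_gt_5 by (auto simp: c_def p_def)
  have "(2 * c - 1 - p)\<^sup>2 - 4 * (c\<^sup>2 - p) = (p + 1)\<^sup>2 + 4 * p - 4 * c * (1 + p)" by (simp add: power2_eq_square algebra_simps)
  also have "(p + 1)\<^sup>2 + 4 * p - 4 * c * (1 + p) < (p + 1)\<^sup>2 + 4 * p - (5 - p) * (1 + p)"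
    using cp by (intro diff_strict_left_mono mult_strict_right_mono) auto
  also have "\<dots> = 2 * (p - 1) * (p + 2)" by (simp add: power2_eq_square algebra_simps)
  also have "\<dots> < 0" using cp by (simp add: mult_neg_pos)
  finally have "(2 * c - 1 - p)\<^sup>2 < 4 * s\<^sup>2" using cp by simp
  then show ?thesis using s by (simp add: dpot_def c_def p_def power_divide divide_simps)
qed

text \<open>This is \<open>1 / 4 < ratio 4 s\<close>, the extreme case of the lower bound. In
  logarithmic form both sides agree in the limit at \<open>0\<close>, and their derivatives compare
  as soon as \<open>4 d + (dpot x)\<^sup>2 < 4\<close> for the derivative \<open>d\<close> of
  \<open>dpot\<close>.\<close>

lemma dpot_upper: "0 < s \<Longrightarrow> (dpot s)\<^sup>2 < 4 * (1 - exp (- pot s / 2))"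
proof -
  assume s: "0 < s"
  have "0 < pot s + 2 * ln (1 - (dpot s)\<^sup>2 / 4)"
  proof (rule limit_less_of_DERIV_pos[OF s])
    show "((\<lambda>s. pot s + 2 * ln (1 - (dpot s)\<^sup>2 / 4)) \<longlongrightarrow> 0) (at_right 0)"
      by (rule tendsto_eq_intros pot_at_0 dpot_at_0 | simp)+
    fix x :: real assume x: "0 < x"
    define c p where "c = s_coth x" and "p = s_csch_sq x"
    define d where "d = (1 - 3 * p + 2 * p * c) / x\<^sup>2"
    have cp: "1 < c" "0 < p" "p < 1" "x\<^sup>2 = c\<^sup>2 - p" "5 < 4 * c + p"
      using x s_coth_gt_1 s_csch_sq_bounds s_coth_s_csch_sq s_coth_s_csch_sq_gt_5 by (auto simp: c_def p_def)
    \<comment> \<open>The quantity \<open>4 d + (dpot x)\<^sup>2 - 4\<close>, multiplied by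
      \<open>x\<^sup>2\<close>, factors into terms of known sign.\<close>
    have eq: "4 * (1 - 3 * p + 2 * p * c) + (2 * c - 1 - p)\<^sup>2 - 4 * (c\<^sup>2 - p) = (1 - p) * (5 - p - 4 * c)"
      by (simp add: power2_eq_square algebra_simps)
    have "\<dots> < 0" using cp by (intro mult_pos_neg) auto
    then have "4 * (1 - 3 * p + 2 * p * c) + (2 * c - 1 - p)\<^sup>2 < 4 * x\<^sup>2"
      unfolding cp(4) using eq by linarith
    then have "(4 * (1 - 3 * p + 2 * p * c) + (2 * c - 1 - p)\<^sup>2) / (4 * x\<^sup>2) < 1"
      using x by simp
    also have "(4 * (1 - 3 * p + 2 * p * c) + (2 * c - 1 - p)\<^sup>2) / (4 * x\<^sup>2) = d + (dpot x)\<^sup>2 / 4"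
      using x by (simp add: d_def dpot_def c_def p_def power_divide field_simps)
    finally have d: "d < 1 - (dpot x)\<^sup>2 / 4" by simp
    have pos: "0 < 1 - (dpot x)\<^sup>2 / 4" using dpot_sq_less_4[OF x] by simp
    have "((\<lambda>s. pot s + 2 * ln (1 - (dpot s)\<^sup>2 / 4)) has_real_derivative
       dpot x * (1 - d / (1 - (dpot x)\<^sup>2 / 4))) (at x)"
      using x pos by (auto intro!: derivative_eq_intros pot_deriv dpot_deriv
         simp: d_def c_def p_def divide_simps) (simp add: algebra_simps)
    moreover have "0 < dpot x * (1 - d / (1 - (dpot x)\<^sup>2 / 4))"
      using d pos dpot_pos[OF x] by (intro mult_pos_pos) (auto simp: divide_simps)
    ultimately show "\<exists>y. ((\<lambda>s. pot s + 2 * ln (1 - (dpot s)\<^sup>2 / 4)) has_real_derivative y) (at x) \<and> 0 < y"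
      by blast
  qed
  then have "exp (- pot s / 2) < exp (ln (1 - (dpot s)\<^sup>2 / 4))" by simp
  also have "\<dots> = 1 - (dpot s)\<^sup>2 / 4" using dpot_sq_less_4[OF s] by simp
  finally show ?thesis by simp
qed

text \<open>For \<open>q = 1\<close> this says that \<open>ratio q\<close> has negative derivative.\<close>

lemma dpot_growth:
  assumes "0 < s"
  shows "(dpot s)\<^sup>2 < (1 - 3 * s_csch_sq s + 2 * s_csch_sq s * s_coth s) / s\<^sup>2 * (exp (2 * pot s) - 1)"
proof -
  \<comment> \<open>Both variables are positive, with \<open>d < 1\<close>, so that positivity of a
    polynomial can be read off from its coefficients.\<close>
  define k d where "k = s_coth s - 1" and "d = 1 - s_csch_sq s"
  have kd: "0 < k" "0 < d" "d < 1" using assms s_coth_gt_1 s_csch_sq_bounds by (auto simp: k_def d_def)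
  have "1 + 2 * k + (2 * k)\<^sup>2 / 2 \<le> exp (2 * k)"
    using kd exp_lower_Taylor_quadratic[of "2 * k"] by simp
  then have e: "1 + 2 * k + 2 * k\<^sup>2 \<le> exp (2 * k)" by (simp add: power2_eq_square)
  have E: "exp (2 * pot s) = exp (2 * k) / (1 - d)"
    using s_csch_sq_bounds[OF assms] by (simp add: pot_def k_def d_def exp_diff right_diff_distrib)
  have dd: "1 - 3 * s_csch_sq s + 2 * s_csch_sq s * s_coth s = d + 2 * (1 - d) * k"
    by (simp add: k_def d_def algebra_simps)
  \<comment> \<open>With \<open>exp (2 * k)\<close> replaced by its quadratic Taylor polynomial, the
    difference of the two sides is a sum of positive terms.\<close>
  have "0 < 2 * k\<^sup>2 * d + d ^ 3 + 2 * k * d\<^sup>2 + 4 * k ^ 3 * (1 - d)"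
    using kd by (intro add_pos_pos mult_pos_pos) auto
  also have "\<dots> = (d + 2 * (1 - d) * k) * ((1 + 2 * k + 2 * k\<^sup>2) - (1 - d)) - (2 * k + d)\<^sup>2 * (1 - d)"
    by (simp add: power2_eq_square power3_eq_cube algebra_simps)
  finally have "(2 * k + d)\<^sup>2 * (1 - d) < (d + 2 * (1 - d) * k) * ((1 + 2 * k + 2 * k\<^sup>2) - (1 - d))" by simp
  also have "\<dots> \<le> (d + 2 * (1 - d) * k) * (exp (2 * k) - (1 - d))"
    using e kd by (intro mult_left_mono) auto
  finally have "(2 * k + d)\<^sup>2 < (d + 2 * (1 - d) * k) * (exp (2 * pot s) - 1)"
    unfolding E using kd by (simp add: field_simps)
  then have "(2 * k + d)\<^sup>2 / s\<^sup>2 < (d + 2 * (1 - d) * k) * (exp (2 * pot s) - 1) / s\<^sup>2"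
    using assms by (simp add: divide_strict_right_mono)
  moreover have "dpot s = (2 * k + d) / s" by (simp add: dpot_def k_def d_def algebra_simps)
  ultimately show ?thesis by (simp add: dd power_divide)
qed

text \<open>This is \<open>((\<rho>(u) + \<rho>(v)) / 2)\<^sup>2\<close> for \<open>u - ln u = v - ln v\<close>, \<open>s = (u - v) / 2\<close>.\<close>

definition ratio :: "real \<Rightarrow> real \<Rightarrow> real" where
  "ratio q s = (1 - exp (- (2 * pot s / q))) / (dpot s)\<^sup>2"

text \<open>Both sides vanish at \<open>0\<close>, and their derivatives are \<open>exp x\<close>
  and \<open>exp (x / q)\<close>. This reduces the monotonicity of \<open>ratio q\<close> for
  \<open>q \<le> 1\<close> to the case \<open>q = 1\<close>.\<close>

lemma exp_minus_one_scale:
  fixes x q :: real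
  assumes "0 < q" "q \<le> 1" "0 \<le> x" shows "exp x - 1 \<le> q * (exp (x / q) - 1)"
proof -
  have "(\<lambda>x. q * (exp (x / q) - 1) - (exp x - 1)) 0 \<le> (\<lambda>x. q * (exp (x / q) - 1) - (exp x - 1)) x"
  proof (rule DERIV_nonneg_imp_nondecreasing[OF assms(3)])
    fix y :: real assume y: "0 \<le> y" "y \<le> x"
    have "y * q \<le> y * 1" using y assms by (intro mult_left_mono) auto
    then have "exp y \<le> exp (y / q)" using assms by (simp add: field_simps)
    then show "\<exists>z. ((\<lambda>x. q * (exp (x / q) - 1) - (exp x - 1)) has_real_derivative z) (at y) \<and> 0 \<le> z"
      using assms by (intro exI[of _ "exp (y / q) - exp y"]) (auto intro!: derivative_eq_intros)
  qed
  then show ?thesis by simp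
qed

text \<open>The derivative has the sign of \<open>a\<^sup>2 - d * (q * (E - 1))\<close>, where
  \<open>a = dpot x\<close>, \<open>d\<close> is the derivative of \<open>dpot\<close> and
  \<open>E = exp (2 * pot x / q)\<close>. For \<open>q = 1\<close> this is negative by
  \<open>dpot_growth\<close>; a smaller \<open>q\<close> does not decrease
  \<open>q * (E - 1)\<close>.\<close>

lemma ratio_strict_antimono:
  assumes q: "0 < q" "q \<le> 1" and "0 < s" "s < t"
  shows "ratio q t < ratio q s"
proof (rule DERIV_neg_imp_decreasing[OF assms(4)])
  fix x assume "s \<le> x" "x \<le> t"
  then have x: "0 < x" using assms by simp
  define d E where "d = (1 - 3 * s_csch_sq x + 2 * s_csch_sq x * s_coth x) / x\<^sup>2" and "E = exp (2 * pot x / q)"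
  define a where "a = dpot x"
  have a: "0 < a" using dpot_pos[OF x] by (simp add: a_def)
  have E1: "1 < E" using pot_pos[OF x] q by (simp add: E_def)
  have g: "a\<^sup>2 < d * (exp (2 * pot x) - 1)"
    using dpot_growth[OF x] by (simp add: d_def a_def)
  \<comment> \<open>A square lies strictly below a product with the positive factor
    \<open>exp (2 * pot x) - 1\<close>, which forces the other factor \<open>d\<close> to be
    positive.\<close>
  have "0 \<le> a\<^sup>2" by simp
  then have "0 < d * (exp (2 * pot x) - 1)" using g by linarith
  then have d: "0 < d" using pot_pos[OF x] by (simp add: zero_less_mult_iff)
  have "d * (exp (2 * pot x) - 1) \<le> d * (q * (E - 1))"
    unfolding E_def using d pot_pos[OF x] q by (intro mult_left_mono exp_minus_one_scale) auto
  then have key: "a\<^sup>2 < d * (q * (E - 1))" using g by linarith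
  have E': "exp (- (2 * pot x / q)) = 1 / E" by (simp add: E_def exp_minus divide_inverse)
  have "(ratio q has_real_derivative
      (2 * a / q / E * a\<^sup>2 - (1 - 1 / E) * (2 * a * d)) / (a\<^sup>2 * a\<^sup>2)) (at x)"
    unfolding ratio_def[abs_def] using q a x
    by (auto intro!: derivative_eq_intros pot_deriv dpot_deriv
        simp: a_def[symmetric] d_def[symmetric] E') (simp add: mult_ac)
  also have "(2 * a / q / E * a\<^sup>2 - (1 - 1 / E) * (2 * a * d)) / (a\<^sup>2 * a\<^sup>2)
      = 2 * (a\<^sup>2 - d * (q * (E - 1))) / (q * E * a ^ 3)"
    using q a E1 by (simp add: field_simps power2_eq_square power3_eq_cube)
  finally have "(ratio q has_real_derivative 2 * (a\<^sup>2 - d * (q * (E - 1))) / (q * E * a ^ 3)) (at x)" .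
  moreover have "2 * (a\<^sup>2 - d * (q * (E - 1))) / (q * E * a ^ 3) < 0"
    using key q a E1 by (intro divide_neg_pos mult_pos_pos) auto
  ultimately show "\<exists>y. (ratio q has_real_derivative y) (at x) \<and> y < 0" by blast
qed

text \<open>\<open>ratio q s\<close> decreases in \<open>q\<close>, so the worst case is
  \<open>q = 4\<close>, which is \<open>dpot_upper\<close>.\<close>

lemma ratio_lower:
  assumes "0 < q" "q \<le> 4" "0 < s" shows "1 / 4 < ratio q s"
proof -
  have "pot s * q \<le> pot s * 4" using assms pot_pos[of s] by (intro mult_left_mono) auto
  then have "exp (- (2 * pot s / q)) \<le> exp (- pot s / 2)" using assms by (simp add: field_simps)
  then have "4 * (1 - exp (- pot s / 2)) \<le> 4 * (1 - exp (- (2 * pot s / q)))"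
    by (intro mult_left_mono diff_left_mono) auto
  then have "(dpot s)\<^sup>2 < 4 * (1 - exp (- (2 * pot s / q)))"
    by (rule less_le_trans[OF dpot_upper[OF assms(3)]])
  then show ?thesis using dpot_pos[OF assms(3)] by (simp add: ratio_def field_simps)
qed

text \<open>By monotonicity in \<open>q\<close> the worst case is \<open>q = 1\<close>. There
  \<open>(dpot s)\<^sup>2 + exp (- (2 * pot s))\<close> tends to \<open>1\<close> at
  \<open>0\<close> and increases, since \<open>exp (- (2 * pot s))\<close> stays below the
  derivative of \<open>dpot\<close>.\<close>

lemma ratio_upper:
  assumes "1 \<le> q" "0 < s" shows "ratio q s < 1"
proof -
  have "1 < (dpot s)\<^sup>2 + exp (- (2 * pot s))"
  proof (rule limit_less_of_DERIV_pos[OF assms(2)])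
    show "((\<lambda>s. (dpot s)\<^sup>2 + exp (- (2 * pot s))) \<longlongrightarrow> 1) (at_right 0)"
      by (rule tendsto_eq_intros pot_at_0 dpot_at_0 | simp)+
    fix x :: real assume x: "0 < x"
    define k d where "k = s_coth x - 1" and "d = 1 - s_csch_sq x"
    have kd: "0 < k" "0 < d" "d < 1" using x s_coth_gt_1 s_csch_sq_bounds by (auto simp: k_def d_def)
    have e: "1 + 2 * k \<le> exp (2 * k)"
      using exp_ge_add_one_self[of "2 * k"] by simp
    have "exp (2 * pot x) = exp (2 * k) / (1 - d)"
      using s_csch_sq_bounds[OF x] by (simp add: pot_def k_def d_def exp_diff right_diff_distrib)
    then have E: "exp (- (2 * pot x)) = (1 - d) * exp (- (2 * k))"
      by (simp add: exp_minus divide_inverse)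
    have dd: "1 - 3 * s_csch_sq x + 2 * s_csch_sq x * s_coth x = d + 2 * (1 - d) * k"
      by (simp add: k_def d_def algebra_simps)
    have x2: "x\<^sup>2 = 2 * k + k\<^sup>2 + d" using s_coth_s_csch_sq[OF x] by (simp add: k_def d_def power2_eq_square algebra_simps)
    \<comment> \<open>Cleared of the denominator \<open>x\<^sup>2\<close>, and with
      \<open>exp (2 * k)\<close> weakened to \<open>1 + 2 * k\<close>, the inequality says that a
      sum of positive terms is positive.\<close>
    have "0 < d * d + 2 * k * d + (1 - d) * (3 * k\<^sup>2)"
      using kd by (intro add_pos_pos mult_pos_pos) auto
    also have "\<dots> = (d + 2 * (1 - d) * k) * (1 + 2 * k) - (1 - d) * x\<^sup>2"
      unfolding x2 by (simp add: power2_eq_square algebra_simps)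
    finally have "(1 - d) * x\<^sup>2 < (d + 2 * (1 - d) * k) * (1 + 2 * k)" by simp
    also have "\<dots> \<le> (d + 2 * (1 - d) * k) * exp (2 * k)"
      using e kd by (intro mult_left_mono) auto
    finally have "exp (- (2 * pot x)) < (1 - 3 * s_csch_sq x + 2 * s_csch_sq x * s_coth x) / x\<^sup>2"
      unfolding E dd using x by (simp add: exp_minus field_simps)
    then have "0 < 2 * dpot x * ((1 - 3 * s_csch_sq x + 2 * s_csch_sq x * s_coth x) / x\<^sup>2 - exp (- (2 * pot x)))"
      using dpot_pos[OF x] by (intro mult_pos_pos) auto
    moreover have "((\<lambda>s. (dpot s)\<^sup>2 + exp (- (2 * pot s))) has_real_derivative
       2 * dpot x * ((1 - 3 * s_csch_sq x + 2 * s_csch_sq x * s_coth x) / x\<^sup>2 - exp (- (2 * pot x)))) (at x)"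
      using x by (auto intro!: derivative_eq_intros pot_deriv dpot_deriv simp: algebra_simps)
    ultimately show "\<exists>y. ((\<lambda>s. (dpot s)\<^sup>2 + exp (- (2 * pot s))) has_real_derivative y) (at x) \<and> 0 < y" by blast
  qed
  moreover have "pot s * 1 \<le> pot s * q" using assms pot_pos[of s] by (intro mult_left_mono) auto
  then have "exp (- (2 * pot s)) \<le> exp (- (2 * pot s / q))" using assms by (simp add: field_simps)
  ultimately have "1 - exp (- (2 * pot s / q)) < (dpot s)\<^sup>2" by linarith
  then show ?thesis using dpot_pos[OF assms(2)] by (simp add: ratio_def field_simps)
qed

text \<open>Here \<open>pot\<close> grows without bound while \<open>dpot\<close> tends to
  \<open>2\<close>. This governs the orbits whose radius tends to \<open>1\<close>.\<close>

lemma ratio_at_top: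
  assumes "0 < q" shows "(ratio q \<longlongrightarrow> 1 / 4) at_top"
proof -
  have c: "filterlim s_coth at_top at_top"
    unfolding s_coth_def[abs_def] sinh_field_def cosh_field_def by real_asymp
  have p: "(s_csch_sq \<longlongrightarrow> 0) at_top"
    unfolding s_csch_sq_def[abs_def] sinh_field_def by real_asymp
  have d: "(dpot \<longlongrightarrow> 2) at_top"
    unfolding dpot_def[abs_def] s_coth_def s_csch_sq_def sinh_field_def cosh_field_def by real_asymp
  have "filterlim pot at_top at_top"
  proof (rule filterlim_at_top_mono)
    show "filterlim (\<lambda>s. s_coth s - 1) at_top at_top"
      using filterlim_tendsto_add_at_top[OF tendsto_const[of "-1"] c] by simp
    show "\<forall>\<^sub>F s in at_top. s_coth s - 1 \<le> pot s"
      using eventually_gt_at_top[of 0]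
      by eventually_elim (use s_csch_sq_bounds in \<open>auto simp: pot_def ln_le_zero_iff intro: less_imp_le\<close>)
  qed
  moreover have "((\<lambda>z. exp (- (2 * z / q))) \<longlongrightarrow> 0) at_top"
    using assms by real_asymp
  ultimately have "((\<lambda>s. exp (- (2 * pot s / q))) \<longlongrightarrow> 0) at_top"
    by (rule filterlim_compose[rotated])
  then have "((\<lambda>s. (1 - exp (- (2 * pot s / q))) / (dpot s)\<^sup>2) \<longlongrightarrow> (1 - 0) / 2\<^sup>2) at_top"
    by (intro tendsto_intros d) auto
  then show ?thesis by (simp add: ratio_def[abs_def])
qed


section \<open>The angular coordinate\<close>

definition defect :: "real \<Rightarrow> real" where "defect u = u - ln u - 1"

text \<open>The sign removes the corner of the root at \<open>u = 1\<close>: \<open>gam q\<close> is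
  differentiable and increasing, and maps the positive reals onto the open interval from
  \<open>-1\<close> to \<open>1\<close>.\<close>

definition gam :: "real \<Rightarrow> real \<Rightarrow> real" where
  "gam q u = sgn (u - 1) * sqrt (1 - exp (- (2 * defect u / q)))"

text \<open>The value at 1 is the limit.\<close>

definition rho :: "real \<Rightarrow> real \<Rightarrow> real" where
  "rho q u = (if u = 1 then 1 / sqrt q else u * gam q u / (u - 1))"

text \<open>Meaningful only for \<open>\<bar>y\<bar> < 1\<close>, the range of \<open>gam q\<close>
  on the positive reals.\<close>

definition ginv :: "real \<Rightarrow> real \<Rightarrow> real" where
  "ginv q y = (THE u. 0 < u \<and> gam q u = y)"

text \<open>The parameter \<open>s = (u - v) / 2\<close> of the two points where
  \<open>gam q\<close> is \<open>y\<close> and \<open>- y\<close>, that is, of the points reached at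
  opposite angles.\<close>

definition half_gap :: "real \<Rightarrow> real \<Rightarrow> real" where
  "half_gap q y = (ginv q y - ginv q (- y)) / 2"

definition rho_sum :: "real \<Rightarrow> real \<Rightarrow> real" where
  "rho_sum q y = rho q (ginv q y) + rho q (ginv q (- y))"

lemma defect_1 [simp]: "defect 1 = 0" by (simp add: defect_def)

lemma defect_pos: "0 < u \<Longrightarrow> u \<noteq> 1 \<Longrightarrow> 0 < defect u"
  using ln_le_minus_one[of u] ln_eq_minus_one[of u] by (force simp: defect_def)

lemma defect_nonneg: "0 < u \<Longrightarrow> 0 \<le> defect u"
  using defect_pos[of u] by (cases "u = 1") auto

text \<open>Equality of the defects says \<open>u = v * exp (2 * s)\<close>; together with
  \<open>u - v = 2 * s\<close> this gives \<open>u = s * exp s / sinh s\<close> and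
  \<open>v = s * exp (- s) / sinh s\<close>, so everything depends on \<open>s\<close>
  alone.\<close>

lemma defect_pair:
  assumes "0 < v" "v < u" "defect u = defect v"
  defines "s \<equiv> (u - v) / 2"
  shows "s_coth s = (u + v) / 2" "s_csch_sq s = u * v" "pot s = defect u" "dpot s = (u - 1) * (1 - v) / s"
proof -
  have s: "0 < s" using assms by simp
  define E where "E = exp s"
  have E: "1 < E" using s by (simp add: E_def)
  have E2: "1 < E * E" using mult_strict_mono[of 1 E 1 E] E by simp
  have "2 * s = u - v" by (simp add: s_def)
  moreover have "u - ln u = v - ln v" using assms(3) by (simp add: defect_def)
  ultimately have "ln u = ln v + 2 * s" by (metis add_diff_cancel_left' add_diff_eq diff_add_cancel diff_diff_eq2)
  then have "exp (ln u) = exp (ln v + 2 * s)" by simp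
  then have u: "u = v * (E * E)" using assms(1,2)
    by (simp add: exp_add E_def flip: exp_add[of s s])
  have vs: "2 * s = v * (E * E - 1)" using u by (simp add: s_def right_diff_distrib)
  have sh: "sinh s = (E * E - 1) / (2 * E)" "cosh s = (E * E + 1) / (2 * E)"
    using E by (auto simp: sinh_field_def cosh_field_def E_def exp_minus field_simps)
  \<comment> \<open>Both sides are the geometric mean of \<open>u\<close> and
    \<open>v\<close>.\<close>
  have c: "s / sinh s = v * E"
  proof -
    have "s / sinh s = 2 * s * E / (E * E - 1)" by (simp add: sh)
    also have "\<dots> = v * E" unfolding vs using E2 by simp
    finally show ?thesis .
  qed
  have "s_coth s = s / sinh s * cosh s" by (simp add: s_coth_def)
  also have "\<dots> = (u + v) / 2" unfolding c using E by (simp add: sh u field_simps)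
  finally show c1: "s_coth s = (u + v) / 2" .
  show p1: "s_csch_sq s = u * v" unfolding s_csch_sq_def c by (simp add: u power2_eq_square)
  show "pot s = defect u" using assms(1,2,3) by (simp add: pot_def c1 p1 ln_mult defect_def field_simps)
  show "dpot s = (u - 1) * (1 - v) / s" unfolding dpot_def c1 p1 by (simp add: algebra_simps)
qed

section \<open>The coordinate \<open>gam\<close> on the positive reals, its inverse, and sums over
  opposite angles\<close>

context
  fixes q :: real
  assumes q_pos: "0 < q"
begin

lemma exp_defect: assumes "0 < u" shows "exp (- (2 * defect u / q)) \<le> 1"
    "u \<noteq> 1 \<Longrightarrow> exp (- (2 * defect u / q)) < 1"
  using defect_nonneg[OF assms] defect_pos[OF assms] q_pos by auto

lemma gam_sq: "0 < u \<Longrightarrow> (gam q u)\<^sup>2 = 1 - exp (- (2 * defect u / q))"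
  using exp_defect[of u] by (cases "u = 1") (auto simp: gam_def power_mult_distrib sgn_if)

lemma gam_1 [simp]: "gam q 1 = 0" by (simp add: gam_def)

lemma gam_pos: "1 < u \<Longrightarrow> 0 < gam q u"
  using exp_defect(2)[of u] by (simp add: gam_def)

lemma gam_neg: "0 < u \<Longrightarrow> u < 1 \<Longrightarrow> gam q u < 0"
  using exp_defect(2)[of u] by (simp add: gam_def)

lemma gam_abs_less_1: "0 < u \<Longrightarrow> \<bar>gam q u\<bar> < 1"
  using gam_sq[of u] by (intro abs_square_less_1[THEN iffD1]) simp

lemma rho_pos: "0 < u \<Longrightarrow> 0 < rho q u"
  using gam_pos[of u] gam_neg[of u] q_pos
  by (cases u "1::real" rule: linorder_cases) (auto simp: rho_def divide_neg_neg mult_pos_neg)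

text \<open>This identity is what \<open>rho\<close> is made for: it turns
  \<open>(sin \<phi>)' = - cos \<phi> (1 - 1 / u)\<close> into one component of a rotation with
  angular velocity \<open>1 / rho q u\<close>.\<close>

lemma rho_gam: "0 < u \<Longrightarrow> gam q u / rho q u = 1 - 1 / u"
  using gam_pos[of u] gam_neg[of u]
  by (cases u "1::real" rule: linorder_cases) (auto simp: rho_def field_simps)

text \<open>\<open>defect u\<close> behaves like \<open>(u - 1)\<^sup>2 / 2\<close> near
  \<open>1\<close>, so the squared quotient tends to \<open>1 / q\<close>; the sign in
  \<open>gam\<close> makes the quotient itself the positive root. The limit is the derivative of
  \<open>gam q\<close> at \<open>1\<close>.\<close>

lemma gam_quot_at_1: "((\<lambda>u. gam q u / (u - 1)) \<longlongrightarrow> 1 / sqrt q) (at 1)"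
proof -
  have "((\<lambda>u. (1 - exp (- (2 * (u - ln u - 1) / q))) / (u - 1)\<^sup>2) \<longlongrightarrow> inverse q) (at 1)"
    using q_pos by real_asymp
  then have "((\<lambda>u. sqrt ((1 - exp (- (2 * (u - ln u - 1) / q))) / (u - 1)\<^sup>2)) \<longlongrightarrow> sqrt (inverse q)) (at 1)"
    by (intro tendsto_intros)
  moreover have "sqrt ((1 - exp (- (2 * (u - ln u - 1) / q))) / (u - 1)\<^sup>2) = gam q u / (u - 1)" for u
  proof -
    have "X / \<bar>w\<bar> = sgn w * X / w" for X w :: real
      by (cases w "0::real" rule: linorder_cases) auto
    then show ?thesis by (simp add: gam_def defect_def real_sqrt_divide)
  qed
  ultimately show ?thesis by (simp add: real_sqrt_inverse divide_inverse)
qed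

lemma defect_deriv: "0 < u \<Longrightarrow> (defect has_real_derivative 1 - 1 / u) (at u)"
  unfolding defect_def[abs_def] by (auto intro!: derivative_eq_intros)

text \<open>Written with \<open>rho\<close>, the derivative needs no exception at \<open>1\<close>.
  There the difference quotient is the one of \<open>gam_quot_at_1\<close>; elsewhere the chain rule
  applies.\<close>

lemma gam_deriv:
  assumes "0 < u"
  shows "(gam q has_real_derivative (1 - (gam q u)\<^sup>2) / (q * rho q u)) (at u)"
proof (cases "u = 1")
  case True
  have "q * (1 / sqrt q) = sqrt q" using q_pos by (simp add: real_div_sqrt)
  then have "(1 - (gam q u)\<^sup>2) / (q * rho q u) = 1 / sqrt q" by (simp add: True rho_def)
  then show ?thesis using gam_quot_at_1 by (simp add: True has_field_derivative_iff)
next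
  case False
  define e where "e = exp (- (2 * defect u / q))"
  have e: "0 < e" "e < 1" using exp_defect(2)[OF assms False] by (auto simp: e_def)
  have gu: "gam q u = sgn (u - 1) * sqrt (1 - e)" by (simp add: gam_def e_def)
  have "((\<lambda>x. sgn (u - 1) * sqrt (1 - exp (- (2 * defect x / q)))) has_real_derivative
     sgn (u - 1) * (((2 * (1 - 1 / u) / q) * e) * (inverse (sqrt (1 - e)) / 2))) (at u)"
    using assms e by (auto intro!: derivative_eq_intros defect_deriv simp: e_def)
  also have "sgn (u - 1) * (((2 * (1 - 1 / u) / q) * e) * (inverse (sqrt (1 - e)) / 2)) =
     (1 - (gam q u)\<^sup>2) / (q * rho q u)"
    unfolding gam_sq[OF assms] rho_def gu e_def[symmetric] using False e q_pos assms
    by (auto simp: sgn_if field_simps)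
  finally show ?thesis
  \<comment> \<open>On the side of \<open>1\<close> that contains \<open>u\<close> the sign is
    constant and may be frozen.\<close>
  proof (rule has_field_derivative_transform_within_open[where S = "if u < 1 then {0<..<1} else {1<..}"])
    fix x :: real assume "x \<in> (if u < 1 then {0<..<1} else {1<..})"
    then show "sgn (u - 1) * sqrt (1 - exp (- (2 * defect x / q))) = gam q x"
      using False by (auto simp: gam_def sgn_if split: if_splits)
  qed (use assms False in auto)
qed

lemma gam_deriv_pos: "0 < u \<Longrightarrow> 0 < (1 - (gam q u)\<^sup>2) / (q * rho q u)"
  using q_pos rho_pos[of u] by (simp add: gam_sq)

lemma gam_strict_mono: "0 < u \<Longrightarrow> u < v \<Longrightarrow> gam q u < gam q v"
  by (rule DERIV_pos_imp_increasing) (auto intro!: exI gam_deriv gam_deriv_pos)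

lemma gam_inj: "0 < u \<Longrightarrow> 0 < v \<Longrightarrow> gam q u = gam q v \<Longrightarrow> u = v"
  using gam_strict_mono[of u v] gam_strict_mono[of v u] by (cases u v rule: linorder_cases) auto

lemma gam_isCont: "0 < u \<Longrightarrow> isCont (gam q) u"
  using gam_deriv DERIV_isCont by blast

lemma rho_isCont: assumes "0 < u" shows "isCont (rho q) u"
proof (cases "u = 1")
  case True
  have "((\<lambda>u. u * (gam q u / (u - 1))) \<longlongrightarrow> 1 * (1 / sqrt q)) (at 1)"
    by (intro tendsto_intros gam_quot_at_1)
  then have "(rho q \<longlongrightarrow> 1 * (1 / sqrt q)) (at 1)"
    by (rule Lim_transform_eventually) (auto simp: rho_def eventually_at_filter)
  then show ?thesis by (simp add: True isCont_def rho_def)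
next
  case False
  have "isCont (\<lambda>u. u * gam q u / (u - 1)) u"
    using assms False by (intro continuous_intros gam_isCont) auto
  moreover have "\<forall>\<^sub>F x in nhds u. u * gam q u / (u - 1) = u * gam q u / (u - 1)" by simp
  moreover have "\<forall>\<^sub>F x in nhds u. rho q x = x * gam q x / (x - 1)"
    using t1_space_nhds[OF False] by eventually_elim (simp add: rho_def)
  ultimately show ?thesis by (subst isCont_cong)
qed

text \<open>\<open>gam q\<close> tends to \<open>1\<close> at infinity and to \<open>-1\<close> at
  \<open>0\<close>; the intermediate value theorem gives the rest.\<close>

lemma gam_surj:
  assumes "-1 < y" "y < 1" obtains u where "0 < u" "gam q u = y"
proof -
  have "((\<lambda>u. exp (- (2 * (u - ln u - 1) / q))) \<longlongrightarrow> 0) at_top" using q_pos by real_asymp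
  then have "((\<lambda>u. sqrt (1 - exp (- (2 * (u - ln u - 1) / q)))) \<longlongrightarrow> sqrt (1 - 0)) at_top"
    by (intro tendsto_intros)
  then have "\<forall>\<^sub>F u in at_top. y < sqrt (1 - exp (- (2 * (u - ln u - 1) / q)))"
    using assms(2) by (intro order_tendstoD) auto
  then have "\<forall>\<^sub>F u in at_top. 1 < u \<and> y < gam q u"
    using eventually_gt_at_top[of 1] by eventually_elim (simp add: gam_def defect_def)
  then obtain b where b: "1 < b" "y < gam q b"
    using eventually_happens'[OF trivial_limit_at_top_linorder] by blast
  have "((\<lambda>u. exp (- (2 * (u - ln u - 1) / q))) \<longlongrightarrow> 0) (at_right 0)" using q_pos by real_asymp
  then have "((\<lambda>u. - sqrt (1 - exp (- (2 * (u - ln u - 1) / q)))) \<longlongrightarrow> - sqrt (1 - 0)) (at_right 0)"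
    by (intro tendsto_intros)
  then have "\<forall>\<^sub>F u in at_right 0. - sqrt (1 - exp (- (2 * (u - ln u - 1) / q))) < y"
    using assms(1) by (intro order_tendstoD) auto
  moreover have "\<forall>\<^sub>F u in at_right 0. (u::real) \<in> {0<..<1}"
    by (intro eventually_at_rightI[of 0 1]) auto
  ultimately have "\<forall>\<^sub>F u in at_right 0. gam q u < y \<and> 0 < u \<and> u < 1"
    by eventually_elim (simp add: gam_def defect_def)
  then obtain a where a: "0 < a" "a < 1" "gam q a < y"
    using eventually_happens'[OF trivial_limit_at_right_real] by blast
  obtain u where u: "a \<le> u" "u \<le> b" "gam q u = y"
  proof -
    have "isCont (gam q) x" if "a \<le> x \<and> x \<le> b" for x
      using that a by (intro gam_isCont) simp
    then show ?thesis using IVT[of "gam q" a y b] a b that by auto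
  qed
  have "0 < u" using u a by simp
  then show ?thesis by (rule that) (fact u(3))
qed

lemma ginv_gam [simp]: "0 < u \<Longrightarrow> ginv q (gam q u) = u"
  unfolding ginv_def using gam_inj by (intro the_equality) auto

lemma gam_ginv: assumes "\<bar>y\<bar> < 1" shows "0 < ginv q y" "gam q (ginv q y) = y"
proof -
  obtain u where "0 < u" "gam q u = y" using gam_surj[of y] assms by (auto simp: abs_less_iff)
  then show "0 < ginv q y" "gam q (ginv q y) = y" using ginv_gam[of u] by auto
qed

lemma ginv_0 [simp]: "ginv q 0 = 1" using ginv_gam[of 1] by simp

lemma ginv_strict_mono: assumes "-1 < y" "y < z" "z < 1" shows "ginv q y < ginv q z"
  using gam_strict_mono[of "ginv q z" "ginv q y"] gam_ginv[of y] gam_ginv[of z] assms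
  by (cases "ginv q y" "ginv q z" rule: linorder_cases) (auto simp: abs_less_iff)

lemma ginv_isCont: assumes "\<bar>y\<bar> < 1" shows "isCont (ginv q) y"
proof -
  have "isCont (ginv q) (gam q (ginv q y))"
  proof (rule isCont_inverse_function[where f = "gam q"])
    show "0 < ginv q y / 2" using gam_ginv[OF assms] by simp
    fix z assume "\<bar>z - ginv q y\<bar> \<le> ginv q y / 2"
    then have "0 < z" using gam_ginv(1)[OF assms] by linarith
    then show "ginv q (gam q z) = z" "isCont (gam q) z" using gam_isCont by auto
  qed
  then show ?thesis using gam_ginv[OF assms] by simp
qed

lemma ginv_deriv: assumes "\<bar>y\<bar> < 1"
  shows "(ginv q has_real_derivative q * rho q (ginv q y) / (1 - y\<^sup>2)) (at y)"
proof -
  let ?D = "(1 - y\<^sup>2) / (q * rho q (ginv q y))"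
  have "(gam q has_real_derivative ?D) (at (ginv q y))"
    using gam_deriv[of "ginv q y"] gam_ginv[OF assms] by simp
  moreover have "?D \<noteq> 0" using gam_deriv_pos[of "ginv q y"] gam_ginv[OF assms] by auto
  ultimately have "(ginv q has_real_derivative inverse ?D) (at y)"
    by (rule DERIV_inverse_function[where a = "-1" and b = 1])
      (use assms in \<open>auto intro!: ginv_isCont gam_ginv simp: abs_less_iff\<close>)
  then show ?thesis by simp
qed

text \<open>The points \<open>u\<close> and \<open>v\<close> where \<open>gam q\<close> is
  \<open>y\<close> and \<open>- y\<close> have the same defect, so \<open>defect_pair\<close>
  applies. The two values of \<open>rho\<close> add up to
  \<open>y * (u - v) / ((u - 1) * (1 - v))\<close>, which is \<open>2 * y / dpot s\<close>, while
  \<open>ratio q s\<close> is \<open>(y / dpot s)\<^sup>2\<close>.\<close>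

lemma half_gap_props:
  assumes "0 < y" "y < 1"
  shows "0 < half_gap q y" "rho_sum q y = 2 * sqrt (ratio q (half_gap q y))"
proof -
  define u v where "u = ginv q y" and "v = ginv q (- y)"
  have u: "1 < u" "gam q u = y" and v: "0 < v" "v < 1" "gam q v = - y"
    using ginv_strict_mono[of 0 y] ginv_strict_mono[of "-y" 0] gam_ginv[of y] gam_ginv[of "-y"] assms
    by (auto simp: u_def v_def)
  have "exp (- (2 * defect u / q)) = exp (- (2 * defect v / q))"
    using gam_sq[of u] gam_sq[of v] u v by simp
  then have d: "defect u = defect v" using q_pos by simp
  have s: "half_gap q y = (u - v) / 2" by (simp add: half_gap_def u_def v_def)
  show s0: "0 < half_gap q y" using u v by (simp add: s)
  have P: "pot (half_gap q y) = defect u" "dpot (half_gap q y) = (u - 1) * (1 - v) / half_gap q y"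
    using defect_pair(3,4)[of v u] u v d by (auto simp: s)
  have y2: "y\<^sup>2 = 1 - exp (- (2 * defect u / q))" using gam_sq[of u] u by simp
  have "ratio q (half_gap q y) = (y / dpot (half_gap q y))\<^sup>2"
    by (simp add: ratio_def P(1) y2 power_divide)
  then have "sqrt (ratio q (half_gap q y)) = y / dpot (half_gap q y)"
    using dpot_pos[OF s0] assms by simp
  also have "2 * \<dots> = y * (u - v) / ((u - 1) * (1 - v))"
    unfolding P(2) unfolding s by simp
  also have "\<dots> = u * y / (u - 1) + v * (- y) / (v - 1)" using u v by (simp add: divide_simps) (simp add: algebra_simps)
  also have "\<dots> = rho_sum q y" using u v by (simp add: rho_sum_def rho_def flip: u_def v_def)
  finally show "rho_sum q y = 2 * sqrt (ratio q (half_gap q y))" by simp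
qed

lemma half_gap_strict_mono: assumes "0 < y" "y < z" "z < 1" shows "half_gap q y < half_gap q z"
  using ginv_strict_mono[of y z] ginv_strict_mono[of "-z" "-y"] assms by (simp add: half_gap_def)

lemma rho_sum_lower: "q \<le> 4 \<Longrightarrow> 0 < y \<Longrightarrow> y < 1 \<Longrightarrow> 1 < rho_sum q y"
  using half_gap_props[of y] ratio_lower[OF q_pos, of "half_gap q y"]
    real_sqrt_less_mono[of "1/4" "ratio q (half_gap q y)"]
  by (simp add: real_sqrt_divide)

lemma rho_sum_upper: "1 \<le> q \<Longrightarrow> 0 < y \<Longrightarrow> y < 1 \<Longrightarrow> rho_sum q y < 2"
  using half_gap_props[of y] ratio_upper[of q "half_gap q y"]
  by simp

lemma rho_sum_strict_antimono: "q \<le> 1 \<Longrightarrow> 0 < y \<Longrightarrow> y < z \<Longrightarrow> z < 1 \<Longrightarrow> rho_sum q z < rho_sum q y"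
  using half_gap_props[of y] half_gap_props[of z] half_gap_strict_mono[of y z]
    ratio_strict_antimono[OF q_pos] by simp

lemma rho_ginv_isCont: "\<bar>y\<bar> < 1 \<Longrightarrow> isCont (\<lambda>y. rho q (ginv q y)) y"
  by (rule isCont_o2[OF ginv_isCont rho_isCont[OF gam_ginv(1)]])

lemma rho_sum_isCont: assumes "\<bar>y\<bar> < 1" shows "isCont (rho_sum q) y"
proof -
  have "isCont (\<lambda>y. rho q (ginv q (- y))) y"
    using assms by (intro isCont_o2[OF _ rho_ginv_isCont] continuous_intros) simp
  then show ?thesis unfolding rho_sum_def[abs_def]
    using rho_ginv_isCont[OF assms] by (intro continuous_intros)
qed

text \<open>Monotonicity is known for positive arguments and extends to \<open>0\<close> by
  continuity. The bound dominates the integrands when the radius tends to \<open>1\<close>.\<close>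

lemma rho_sum_le_0: assumes "q \<le> 1" "0 \<le> y" "y < 1" shows "rho_sum q y \<le> rho_sum q 0"
proof (cases "y = 0")
  case False
  have "(rho_sum q \<longlongrightarrow> rho_sum q 0) (at_right 0)"
    using rho_sum_isCont[of 0] by (simp add: isCont_def filterlim_at_split)
  then show ?thesis
  proof (rule tendsto_lowerbound)
    show "\<forall>\<^sub>F x in at_right 0. rho_sum q y \<le> rho_sum q x"
      using assms False rho_sum_strict_antimono[of _ y]
      by (intro eventually_at_rightI[of 0 y]) (auto intro: less_imp_le)
  qed auto
qed auto

text \<open>As \<open>y\<close> tends to \<open>1\<close>, the half gap grows without bound, so the
  limit of \<open>ratio\<close> at infinity applies.\<close>

lemma rho_sum_at_1: "(rho_sum q \<longlongrightarrow> 1) (at_left 1)"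
proof -
  have "filterlim (half_gap q) at_top (at_left 1)"
    unfolding filterlim_at_top_gt[where c = 0]
  proof (intro allI impI)
    fix Z :: real assume Z: "0 < Z"
    \<comment> \<open>Past this value the larger of the two points exceeds \<open>1 + 2 * Z\<close>,
      and the smaller one is below \<open>1\<close>.\<close>
    let ?y = "gam q (1 + 2 * Z)"
    have y: "0 < ?y" "?y < 1" using gam_pos[of "1 + 2 * Z"] gam_abs_less_1[of "1 + 2 * Z"] Z by auto
    show "\<forall>\<^sub>F x in at_left 1. Z \<le> half_gap q x"
    proof (intro eventually_at_leftI[of ?y])
      fix x assume x: "x \<in> {?y<..<1}"
      have "ginv q ?y < ginv q x" "ginv q (-x) < ginv q 0"
        using x y by (intro ginv_strict_mono; simp)+
      moreover have "ginv q ?y = 1 + 2 * Z" using Z by (intro ginv_gam) simp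
      ultimately show "Z \<le> half_gap q x" by (simp add: half_gap_def)
    qed (use y in auto)
  qed
  then have "((\<lambda>y. ratio q (half_gap q y)) \<longlongrightarrow> 1 / 4) (at_left 1)"
    by (rule filterlim_compose[OF ratio_at_top[OF q_pos]])
  then have "((\<lambda>y. 2 * sqrt (ratio q (half_gap q y))) \<longlongrightarrow> 2 * sqrt (1 / 4)) (at_left 1)"
    by (intro tendsto_intros)
  moreover have "\<forall>\<^sub>F y in at_left 1. 2 * sqrt (ratio q (half_gap q y)) = rho_sum q y"
    by (intro eventually_at_leftI[of 0]) (auto simp: half_gap_props(2))
  ultimately show ?thesis by (simp add: real_sqrt_divide Lim_transform_eventually)
qed

end


section \<open>The period function\<close>

text \<open>At angle \<open>t\<close> of the orbit of radius \<open>S\<close>, \<open>kap S t\<close> is \<open>cos \<phi>\<close> and \<open>Gam S t\<close> is \<open>\<gamma>(u)\<close>.\<close>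

definition kap :: "real \<Rightarrow> real \<Rightarrow> real" where
  "kap S t = sqrt (1 - S\<^sup>2 * (cos t)\<^sup>2)"

definition Gam :: "real \<Rightarrow> real \<Rightarrow> real" where
  "Gam S t = S * sin t / kap S t"

text \<open>Time per unit of angle, the reciprocal of the angular velocity along the orbit.\<close>

definition rate :: "real \<Rightarrow> real \<Rightarrow> real \<Rightarrow> real" where
  "rate q S t = rho q (ginv q (Gam S t))"

definition period :: "real \<Rightarrow> real \<Rightarrow> real" where
  "period q S = integral {0..2 * pi} (rate q S)"

lemma kap_radicand:
  fixes S t :: real
  assumes "0 \<le> S" "S < 1"
  shows "0 < 1 - S\<^sup>2 * (cos t)\<^sup>2"
proof -
  have "S\<^sup>2 * (cos t)\<^sup>2 \<le> S\<^sup>2 * 1" using abs_cos_le_one[of t]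
    by (intro mult_left_mono) (auto simp: abs_square_le_1)
  also have "S\<^sup>2 * 1 < 1" using assms by (simp add: abs_square_less_1)
  finally show ?thesis by simp
qed

lemma kap_pos: "0 \<le> S \<Longrightarrow> S < 1 \<Longrightarrow> 0 < kap S t"
  using kap_radicand[of S t] by (simp add: kap_def)

lemma kap_sq: "0 \<le> S \<Longrightarrow> S < 1 \<Longrightarrow> (kap S t)\<^sup>2 = 1 - S\<^sup>2 * (cos t)\<^sup>2"
  using kap_radicand[of S t] by (simp add: kap_def)

text \<open>With \<open>C\<^sup>2 = 1 - S\<^sup>2\<close> this is the constancy of
  \<open>C = cos \<phi> exp (- defect u / q)\<close> in terms of the angle.\<close>

lemma one_minus_Gam_sq: "0 \<le> S \<Longrightarrow> S < 1 \<Longrightarrow> 1 - (Gam S t)\<^sup>2 = (1 - S\<^sup>2) / (kap S t)\<^sup>2"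
  using kap_radicand[of S t] kap_sq[of S t]
  by (simp add: Gam_def power_divide power_mult_distrib sin_squared_eq divide_simps) (simp add: algebra_simps)

lemma Gam_abs_le: assumes "0 \<le> S" "S < 1" shows "\<bar>Gam S t\<bar> \<le> S"
proof -
  have "(Gam S t)\<^sup>2 = 1 - (1 - S\<^sup>2) / (kap S t)\<^sup>2" using one_minus_Gam_sq[OF assms, of t] by simp
  also have "\<dots> \<le> 1 - (1 - S\<^sup>2) / 1"
    using kap_radicand[OF assms, of t] kap_sq[OF assms, of t] assms
    by (intro diff_left_mono divide_left_mono) (auto simp: power_le_one)
  finally have "(Gam S t)\<^sup>2 \<le> S\<^sup>2" by simp
  then show ?thesis using assms by (simp add: abs_le_square_iff[symmetric])
qed

lemma Gam_abs_less: "0 \<le> S \<Longrightarrow> S < 1 \<Longrightarrow> \<bar>Gam S t\<bar> < 1"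
  using Gam_abs_le[of S t] by simp

lemma Gam_less_1: "0 \<le> S \<Longrightarrow> S < 1 \<Longrightarrow> Gam S t < 1"
  using Gam_abs_less[of S t] by simp

lemma Gam_0 [simp]: "Gam S 0 = 0" "Gam S pi = 0" by (auto simp: Gam_def)

lemma Gam_add_pi: "Gam S (t + pi) = - Gam S t" by (simp add: Gam_def kap_def)

lemma Gam_add_2pi: "Gam S (t + 2 * pi) = Gam S t" by (simp add: Gam_def kap_def)

lemma Gam_pos: "0 < S \<Longrightarrow> S < 1 \<Longrightarrow> 0 < t \<Longrightarrow> t < pi \<Longrightarrow> 0 < Gam S t"
  using kap_pos[of S t] sin_gt_zero[of t] by (simp add: Gam_def)

lemma Gam_nonneg: "0 \<le> S \<Longrightarrow> S < 1 \<Longrightarrow> 0 \<le> t \<Longrightarrow> t \<le> pi \<Longrightarrow> 0 \<le> Gam S t"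
  using kap_pos[of S t] sin_ge_zero[of t] by (simp add: Gam_def)

text \<open>As the radius grows, the numerator increases and \<open>kap\<close> does not. This
  carries the monotonicity of \<open>rho_sum\<close> over to the period.\<close>

lemma Gam_strict_mono:
  assumes "0 < S" "S < R" "R < 1" "0 < t" "t < pi" shows "Gam S t < Gam R t"
proof -
  have "R\<^sup>2 * (cos t)\<^sup>2 \<ge> S\<^sup>2 * (cos t)\<^sup>2" using assms by (intro mult_right_mono power_mono) auto
  then have k: "kap R t \<le> kap S t" by (simp add: kap_def)
  have "Gam S t = S * sin t / kap S t" by (simp add: Gam_def)
  also have "\<dots> \<le> S * sin t / kap R t"
    using k kap_pos[of R t] kap_pos[of S t] sin_gt_zero[of t] assms by (intro divide_left_mono) auto
  also have "\<dots> < R * sin t / kap R t"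
    using kap_pos[of R t] sin_gt_zero[of t] assms by (intro divide_strict_right_mono mult_strict_right_mono) auto
  also have "\<dots> = Gam R t" by (simp add: Gam_def)
  finally show ?thesis .
qed

lemma kap_deriv:
  assumes "0 \<le> S" "S < 1"
  shows "(kap S has_real_derivative S\<^sup>2 * cos t * sin t / kap S t) (at t)"
proof -
  have "((\<lambda>t. sqrt (1 - S\<^sup>2 * (cos t)\<^sup>2)) has_real_derivative
      (2 * S\<^sup>2 * cos t * sin t) * (inverse (sqrt (1 - S\<^sup>2 * (cos t)\<^sup>2)) / 2)) (at t)"
    using kap_radicand[OF assms, of t] by (auto intro!: derivative_eq_intros)
  then have "(kap S has_real_derivative
      (2 * S\<^sup>2 * cos t * sin t) * (inverse (kap S t) / 2)) (at t)"
    by (simp only: kap_def[abs_def])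
  then show ?thesis by (rule DERIV_cong) (simp add: field_simps)
qed

lemma Gam_deriv:
  assumes "0 \<le> S" "S < 1"
  shows "(Gam S has_real_derivative S * cos t * (1 - (Gam S t)\<^sup>2) / kap S t) (at t)"
proof -
  have k: "0 < kap S t" using kap_pos[OF assms] .
  have "((\<lambda>t. S * sin t / kap S t) has_real_derivative
     (S * cos t * kap S t - S * sin t * (S\<^sup>2 * cos t * sin t / kap S t)) / (kap S t * kap S t)) (at t)"
    using k by (auto intro!: derivative_eq_intros kap_deriv assms)
  also have "(S * cos t * kap S t - S * sin t * (S\<^sup>2 * cos t * sin t / kap S t)) / (kap S t * kap S t)
     = S * cos t * (1 - (Gam S t)\<^sup>2) / kap S t"
    using k by (simp add: Gam_def field_simps power2_eq_square)
  finally show ?thesis unfolding Gam_def[abs_def] .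
qed

lemma continuous_on_Gam: "continuous_on ({0..<1} \<times> UNIV) (\<lambda>(S, t). Gam S t)"
proof -
  have "kap S t \<noteq> 0" if "0 \<le> S" "S < 1" for S t using kap_pos[OF that, of t] by simp
  then have "continuous_on ({0..<1} \<times> UNIV) (\<lambda>x. fst x * sin (snd x) / sqrt (1 - (fst x)\<^sup>2 * (cos (snd x))\<^sup>2))"
    by (intro continuous_intros) (auto simp: kap_def)
  then show ?thesis by (simp add: Gam_def kap_def case_prod_unfold)
qed

lemma Gam_isCont: "0 \<le> S \<Longrightarrow> S < 1 \<Longrightarrow> isCont (Gam S) t"
  using Gam_deriv DERIV_isCont by blast

section \<open>The period as a function of the radius\<close>

context
  fixes q :: real
  assumes q_pos: "0 < q"
begin

lemma rate_isCont: "0 \<le> S \<Longrightarrow> S < 1 \<Longrightarrow> isCont (rate q S) t"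
  unfolding rate_def[abs_def]
  by (rule isCont_o2[OF Gam_isCont rho_ginv_isCont[OF q_pos Gam_abs_less]])

lemma rate_pos: "0 \<le> S \<Longrightarrow> S < 1 \<Longrightarrow> 0 < rate q S t"
  unfolding rate_def by (intro rho_pos gam_ginv q_pos Gam_abs_less)

lemma rate_add_2pi: "rate q S (t + 2 * pi) = rate q S t"
  by (simp add: rate_def Gam_add_2pi)

text \<open>A shift by \<open>pi\<close> changes the sign of \<open>Gam\<close>, so the second half
  of the turn pairs with the first into \<open>rho_sum\<close>.\<close>

lemma period_eq:
  assumes "0 \<le> S" "S < 1"
  shows "period q S = integral {0..pi} (\<lambda>t. rho_sum q (Gam S t))"
proof -
  have c: "continuous_on A (rate q S)" for A
    using rate_isCont[OF assms] by (intro continuous_at_imp_continuous_on) auto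
  have "period q S = integral {0..pi} (rate q S) + integral {pi..2 * pi} (rate q S)"
    unfolding period_def
    by (intro Henstock_Kurzweil_Integration.integral_combine[symmetric] integrable_continuous_real c) auto
  also have "integral {pi..2 * pi} (rate q S) = integral {0..pi} (rate q S \<circ> (\<lambda>t. t + pi))"
    using integral_shift[of 0 pi pi "rate q S"] c by simp
  also have "integral {0..pi} (rate q S) + \<dots> = integral {0..pi} (\<lambda>t. rate q S t + (rate q S \<circ> (\<lambda>t. t + pi)) t)"
    by (intro Henstock_Kurzweil_Integration.integral_add[symmetric] integrable_continuous_real c
       continuous_on_compose continuous_intros)
  also have "(\<lambda>t. rate q S t + (rate q S \<circ> (\<lambda>t. t + pi)) t) = (\<lambda>t. rho_sum q (Gam S t))"
    by (auto simp: rate_def rho_sum_def Gam_add_pi)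
  finally show ?thesis .
qed

lemma continuous_on_rho_sum_Gam:
  "continuous_on ({0..<1} \<times> UNIV) (\<lambda>(S, t). rho_sum q (Gam S t))"
proof -
  have 1: "continuous_on {-1<..<1} (rho_sum q)"
    by (intro continuous_at_imp_continuous_on ballI rho_sum_isCont[OF q_pos]) auto
  have "continuous_on ({0..<1} \<times> UNIV) (\<lambda>x. rho_sum q (case x of (S, t) \<Rightarrow> Gam S t))"
    by (rule continuous_on_compose2[OF 1 continuous_on_Gam])
      (use Gam_abs_less in \<open>auto simp: abs_less_iff minus_less_iff\<close>)
  then show ?thesis by (simp add: case_prod_unfold)
qed

lemma continuous_on_period: "continuous_on {0..<1} (period q)"
proof -
  have "continuous_on ({0..<1} \<times> cbox 0 pi) (\<lambda>(S, t). rho_sum q (Gam S t))"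
    by (rule continuous_on_subset[OF continuous_on_rho_sum_Gam]) auto
  then have "continuous_on {0..<1} (\<lambda>S. integral (cbox 0 pi) (\<lambda>t. rho_sum q (Gam S t)))"
    by (rule integral_continuous_on_param)
  then show ?thesis by (subst continuous_on_cong[OF refl period_eq]) auto
qed

lemma greaterThanLessThan_0_pi_nonempty: "{0<..<pi} \<noteq> {}"
  using pi_gt_zero by (simp add: not_le)

lemma rho_sum_Gam_cont: "0 \<le> S \<Longrightarrow> S < 1 \<Longrightarrow> continuous_on A (\<lambda>t. rho_sum q (Gam S t))"
  using isCont_o2[OF Gam_isCont rho_sum_isCont[OF q_pos Gam_abs_less]]
  by (intro continuous_at_imp_continuous_on) auto

text \<open>The pointwise bound holds at interior angles, where \<open>Gam\<close> is positive, and
  that suffices for a strict inequality of integrals. It excludes solutions that make several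
  turns.\<close>

lemma period_gt_pi:
  assumes "q \<le> 4" "0 < S" "S < 1" shows "pi < period q S"
proof -
  have "integral {0..pi} (\<lambda>t. 1) < integral {0..pi} (\<lambda>t. rho_sum q (Gam S t))"
  proof (rule integral_less_real[OF _ _ greaterThanLessThan_0_pi_nonempty])
    fix t assume "t \<in> {0<..<pi}"
    then show "1 < rho_sum q (Gam S t)"
      using assms by (intro rho_sum_lower[OF q_pos] Gam_pos Gam_less_1) auto
  qed (use assms rho_sum_Gam_cont in auto)
  then show ?thesis using assms by (simp add: period_eq)
qed

lemma period_less_2pi:
  assumes "1 \<le> q" "0 < S" "S < 1" shows "period q S < 2 * pi"
proof -
  have "integral {0..pi} (\<lambda>t. rho_sum q (Gam S t)) < integral {0..pi} (\<lambda>t. 2)"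
  proof (rule integral_less_real[OF _ _ greaterThanLessThan_0_pi_nonempty])
    fix t assume "t \<in> {0<..<pi}"
    then show "rho_sum q (Gam S t) < 2"
      using assms by (intro rho_sum_upper[OF q_pos] Gam_pos Gam_less_1) auto
  qed (use assms rho_sum_Gam_cont in auto)
  then show ?thesis using assms by (simp add: period_eq)
qed

lemma period_strict_antimono:
  assumes "q \<le> 1" "0 < S" "S < R" "R < 1" shows "period q R < period q S"
proof -
  have "integral {0..pi} (\<lambda>t. rho_sum q (Gam R t)) < integral {0..pi} (\<lambda>t. rho_sum q (Gam S t))"
  proof (rule integral_less_real[OF _ _ greaterThanLessThan_0_pi_nonempty])
    fix t assume "t \<in> {0<..<pi}"
    then show "rho_sum q (Gam R t) < rho_sum q (Gam S t)"
      using assms by (intro rho_sum_strict_antimono[OF q_pos] Gam_pos Gam_less_1 Gam_strict_mono) auto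
  qed (use assms rho_sum_Gam_cont in auto)
  then show ?thesis using assms by (simp add: period_eq)
qed

text \<open>Small orbits stay near \<open>u = 1\<close>, where \<open>rho_sum\<close> is close to
  \<open>2 / sqrt q > 2\<close>.\<close>

lemma ex_period_gt_2pi:
  assumes "q < 1" obtains S where "0 < S" "S < 1" "2 * pi < period q S"
proof -
  have "sqrt q < 1" using assms by simp
  then have "2 < rho_sum q 0" using q_pos by (simp add: rho_sum_def ginv_0[OF q_pos] rho_def field_simps)
  then have "\<forall>\<^sub>F y in at 0. 2 < rho_sum q y"
    using rho_sum_isCont[OF q_pos, of 0] by (intro order_tendstoD) (auto simp: isCont_def)
  then obtain d where d: "0 < d" "\<And>y. y \<noteq> 0 \<Longrightarrow> \<bar>y\<bar> < d \<Longrightarrow> 2 < rho_sum q y"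
    by (auto simp: eventually_at dist_real_def)
  define S where "S = min (d / 2) (1 / 2)"
  have S: "0 < S" "S < 1" "S < d" using d by (auto simp: S_def min_def)
  have "integral {0..pi} (\<lambda>t. 2) < integral {0..pi} (\<lambda>t. rho_sum q (Gam S t))"
  proof (rule integral_less_real[OF _ _ greaterThanLessThan_0_pi_nonempty])
    fix t assume t: "t \<in> {0<..<pi}"
    show "2 < rho_sum q (Gam S t)"
      using Gam_pos[of S t] Gam_abs_le[of S t] S t by (intro d(2)) auto
  qed (use S rho_sum_Gam_cont in auto)
  then show ?thesis using S that by (simp add: period_eq)
qed

text \<open>As the radius tends to \<open>1\<close>, \<open>Gam\<close> tends to \<open>1\<close> at
  every interior angle, so \<open>rho_sum\<close> tends to \<open>1\<close> there and the period
  tends to \<open>pi\<close> by dominated convergence.\<close>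

lemma ex_period_less_2pi:
  assumes "q < 1" "0 < S0" "S0 < 1" obtains S where "S0 < S" "S < 1" "period q S < 2 * pi"
proof -
  \<comment> \<open>The offset \<open>2\<close> keeps \<open>S n\<close> strictly between
    \<open>0\<close> and \<open>1\<close> from \<open>n = 0\<close> on.\<close>
  define S :: "nat \<Rightarrow> real" where "S n = 1 - 1 / (real n + 2)" for n
  have S: "0 < S n" "S n < 1" for n by (auto simp: S_def field_simps)
  have Slim: "S \<longlonglongrightarrow> 1" unfolding S_def by real_asymp
  \<comment> \<open>At both endpoints \<open>Gam\<close> vanishes for every radius, so the limit
    there is \<open>rho_sum q 0\<close>; two points do not affect the integral.\<close>
  let ?g = "\<lambda>t. if t = 0 \<or> t = pi then rho_sum q 0 else 1"
  have "(\<lambda>n. integral {0..pi} (\<lambda>t. rho_sum q (Gam (S n) t))) \<longlonglongrightarrow> integral {0..pi} ?g"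
  proof (rule dominated_convergence(2))
    show "(\<lambda>t. rho_sum q (Gam (S n) t)) integrable_on {0..pi}" for n
      using S[of n] by (intro integrable_continuous_real rho_sum_Gam_cont) auto
    show "(\<lambda>t. rho_sum q 0) integrable_on {0..pi}" by (intro integrable_continuous_real continuous_intros)
    show "norm (rho_sum q (Gam (S n) t)) \<le> rho_sum q 0" if "t \<in> {0..pi}" for n t
    proof -
      have g: "0 \<le> Gam (S n) t" "Gam (S n) t < 1"
        using S[of n] that Gam_nonneg[of "S n" t] Gam_less_1[of "S n" t] by auto
      have "0 < rho_sum q (Gam (S n) t)" unfolding rho_sum_def
        using g by (intro add_pos_pos rho_pos gam_ginv q_pos) auto
      then show ?thesis using rho_sum_le_0[OF q_pos _ g] assms by simp
    qed
    fix t assume t: "t \<in> {0..pi}"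
    show "(\<lambda>n. rho_sum q (Gam (S n) t)) \<longlonglongrightarrow> ?g t"
    proof (cases "t = 0 \<or> t = pi")
      case False
      then have t': "0 < t" "t < pi" using t by auto
      have s: "0 < sin t" using t' by (rule sin_gt_zero)
      have k: "1 - 1\<^sup>2 * (cos t)\<^sup>2 = (sin t)\<^sup>2" by (simp add: sin_squared_eq)
      have "(\<lambda>n. S n * sin t / sqrt (1 - (S n)\<^sup>2 * (cos t)\<^sup>2)) \<longlonglongrightarrow> 1 * sin t / sqrt (1 - 1\<^sup>2 * (cos t)\<^sup>2)"
        using s by (intro tendsto_intros Slim) (simp only: k, simp)
      then have "(\<lambda>n. Gam (S n) t) \<longlonglongrightarrow> 1"
        using s unfolding k by (simp add: Gam_def kap_def)
      then have "filterlim (\<lambda>n. Gam (S n) t) (at_left 1) sequentially"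
        using Gam_less_1[of "S _" t] S by (intro tendsto_imp_filterlim_at_left) (auto simp: less_imp_le)
      then have "(\<lambda>n. rho_sum q (Gam (S n) t)) \<longlonglongrightarrow> 1"
        by (rule filterlim_compose[OF rho_sum_at_1[OF q_pos]])
      then show ?thesis using False by simp
    qed auto
  qed
  also have "integral {0..pi} ?g = integral {0..pi} (\<lambda>t. 1)"
    by (rule integral_spike[of "{0, pi}"]) auto
  also have "(\<lambda>n. integral {0..pi} (\<lambda>t. rho_sum q (Gam (S n) t))) = (\<lambda>n. period q (S n))"
    using S by (simp add: period_eq less_imp_le)
  finally have "(\<lambda>n. period q (S n)) \<longlonglongrightarrow> pi" by simp
  then have "\<forall>\<^sub>F n in sequentially. period q (S n) < 2 * pi"
    by (rule order_tendstoD) simp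
  moreover have "\<forall>\<^sub>F n in sequentially. S0 < S n"
    using Slim assms by (intro order_tendstoD)
  ultimately have "\<forall>\<^sub>F n in sequentially. S0 < S n \<and> period q (S n) < 2 * pi"
    by eventually_elim simp
  then obtain n where "S0 < S n \<and> period q (S n) < 2 * pi"
    using eventually_happens'[OF sequentially_bot] by blast
  then show ?thesis using that S by blast
qed

lemma ex_period_eq_2pi:
  assumes "q < 1" obtains S where "0 < S" "S < 1" "period q S = 2 * pi"
proof -
  obtain A where A: "0 < A" "A < 1" "2 * pi < period q A" using ex_period_gt_2pi[OF assms] .
  obtain B where B: "A < B" "B < 1" "period q B < 2 * pi" using ex_period_less_2pi[OF assms A(1,2)] .
  have "continuous_on {A..B} (period q)"
    by (rule continuous_on_subset[OF continuous_on_period]) (use A B in auto)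
  then obtain S where S: "A \<le> S" "S \<le> B" "period q S = 2 * pi"
    using IVT2'[of "period q" B "2 * pi" A] A B by auto
  show ?thesis by (rule that[OF _ _ S(3)]) (use S A B in auto)
qed

text \<open>An antiderivative of the rate measures time along the orbit as a function of the angle.
  Its increase over a turn does not depend on the starting angle because the rate is
  periodic.\<close>

lemma ex_clock:
  assumes "0 \<le> S" "S < 1"
  obtains F where "\<And>t. (F has_real_derivative rate q S t) (at t)"
    "\<And>t. F (t + 2 * pi) = F t + period q S"
proof -
  obtain F where F: "\<And>t. (F has_real_derivative rate q S t) (at t)"
    using einterval_antiderivative[of "-\<infinity>" "\<infinity>" "rate q S"] rate_isCont[OF assms]
    by (auto simp: has_real_derivative_iff_has_vector_derivative)
  have "((\<lambda>t. F (t + 2 * pi) - F t) has_real_derivative 0) (at t)" for t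
  proof -
    have "((\<lambda>t. F (t + 2 * pi)) has_real_derivative rate q S (t + 2 * pi)) (at t)"
      using F[of "t + 2 * pi"] unfolding DERIV_shift .
    from DERIV_diff[OF this F] show ?thesis by (simp add: rate_add_2pi)
  qed
  then have const: "F (t + 2 * pi) - F t = F (0 + 2 * pi) - F 0" for t
    using DERIV_isconst_all[of "\<lambda>t. F (t + 2 * pi) - F t" t 0] by simp
  have "(rate q S has_integral (F (2 * pi) - F 0)) {0..2 * pi}"
    using F by (intro fundamental_theorem_of_calculus)
      (auto simp: has_real_derivative_iff_has_vector_derivative intro: has_vector_derivative_at_within)
  then have "period q S = F (2 * pi) - F 0" unfolding period_def by (rule integral_unique)
  then have "F (t + 2 * pi) = F t + period q S" for t using const[of t] by simp
  then show ?thesis using F that by blast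
qed

end


section \<open>Solutions are orbits\<close>

text \<open>Take for \<open>\<tau>\<close> the antiderivative of \<open>\<omega>\<close> that starts
  at the polar angle of the initial point. In the frame rotating by \<open>\<tau>\<close> the point
  \<open>(X, Y)\<close> stands still.\<close>

lemma rotation_lift:
  fixes X Y \<omega> :: "real \<Rightarrow> real"
  assumes X: "\<And>t. (X has_real_derivative - Y t * \<omega> t) (at t)"
    and Y: "\<And>t. (Y has_real_derivative X t * \<omega> t) (at t)"
    and \<omega>: "\<And>t. isCont \<omega> t" and S: "0 < S" "(X 0)\<^sup>2 + (Y 0)\<^sup>2 = S\<^sup>2"
  obtains \<tau> where "\<And>t. (\<tau> has_real_derivative \<omega> t) (at t)"
    "\<And>t. X t = S * cos (\<tau> t)" "\<And>t. Y t = S * sin (\<tau> t)"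
proof -
  have "(X 0 / S)\<^sup>2 + (Y 0 / S)\<^sup>2 = 1"
    using S by (simp add: power_divide flip: add_divide_distrib)
  then obtain a where a: "X 0 / S = cos a" "Y 0 / S = sin a"
    by (rule sincos_total_2pi)
  obtain G where G: "\<And>t. (G has_real_derivative \<omega> t) (at t)"
    using einterval_antiderivative[of "-\<infinity>" "\<infinity>" \<omega>] \<omega>
    by (auto simp: has_real_derivative_iff_has_vector_derivative)
  define \<tau> where "\<tau> t = G t - G 0 + a" for t
  have \<tau>: "(\<tau> has_real_derivative \<omega> t) (at t)" for t
    unfolding \<tau>_def[abs_def] by (auto intro!: derivative_eq_intros G)
  have "((\<lambda>t. X t * cos (\<tau> t) + Y t * sin (\<tau> t)) has_real_derivative 0) (at t)" for t
    by (auto intro!: derivative_eq_intros X Y \<tau> simp: algebra_simps)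
  then have 1: "X t * cos (\<tau> t) + Y t * sin (\<tau> t) = S" for t
    using DERIV_isconst_all[of "\<lambda>t. X t * cos (\<tau> t) + Y t * sin (\<tau> t)" t 0] a S
    by (simp add: \<tau>_def field_simps flip: distrib_left power2_eq_square)
  have "((\<lambda>t. Y t * cos (\<tau> t) - X t * sin (\<tau> t)) has_real_derivative 0) (at t)" for t
    by (auto intro!: derivative_eq_intros X Y \<tau> simp: algebra_simps)
  then have 2: "Y t * cos (\<tau> t) - X t * sin (\<tau> t) = 0" for t
    using DERIV_isconst_all[of "\<lambda>t. Y t * cos (\<tau> t) - X t * sin (\<tau> t)" t 0] a S
    by (simp add: \<tau>_def field_simps)
  have X': "X t = S * cos (\<tau> t)" for t
  proof -
    have "X t = X t * ((sin (\<tau> t))\<^sup>2 + (cos (\<tau> t))\<^sup>2)" by simp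
    also have "\<dots> = cos (\<tau> t) * (X t * cos (\<tau> t) + Y t * sin (\<tau> t))
        - sin (\<tau> t) * (Y t * cos (\<tau> t) - X t * sin (\<tau> t))"
      unfolding power2_eq_square by (simp only: algebra_simps)
    finally show ?thesis by (simp add: 1 2)
  qed
  have Y': "Y t = S * sin (\<tau> t)" for t
  proof -
    have "Y t = Y t * ((sin (\<tau> t))\<^sup>2 + (cos (\<tau> t))\<^sup>2)" by simp
    also have "\<dots> = sin (\<tau> t) * (X t * cos (\<tau> t) + Y t * sin (\<tau> t))
        + cos (\<tau> t) * (Y t * cos (\<tau> t) - X t * sin (\<tau> t))"
      unfolding power2_eq_square by (simp only: algebra_simps)
    finally show ?thesis by (simp add: 1 2)
  qed
  show ?thesis using that \<tau> X' Y' by blast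
qed

text \<open>This is \<open>h = r cos \<phi>\<close> at angle \<open>t\<close>, with
  \<open>r = u powr (1 / q)\<close> and \<open>cos \<phi> = kap S t\<close>.\<close>

definition orbit :: "real \<Rightarrow> real \<Rightarrow> real \<Rightarrow> real" where
  "orbit q S t = ginv q (Gam S t) powr (1 / q) * kap S t"

locale dual_solution =
  fixes q :: real and h :: "real \<Rightarrow> real"
  assumes q_pos: "0 < q" and solution: "h \<in> solutions q"
begin

definition r :: "real \<Rightarrow> real" where "r t = sqrt ((deriv h t)\<^sup>2 + (h t)\<^sup>2)"

definition u :: "real \<Rightarrow> real" where "u t = r t powr q"

lemma h_pos: "0 < h t" and h_periodic: "h (t + 2 * pi) = h t"
  using solution by (auto simp: solutions_def)

lemma r_pos: "0 < r t" and r_sq: "(r t)\<^sup>2 = (deriv h t)\<^sup>2 + (h t)\<^sup>2"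
  using h_pos[of t] by (auto simp: r_def add_nonneg_pos)

lemma u_pos: "0 < u t"
  using r_pos[of t] by (simp add: u_def)

lemma h_deriv: "(h has_real_derivative deriv h t) (at t)"
  using solution by (auto simp: solutions_def C2_def differentiable_on_def
    DERIV_deriv_iff_real_differentiable)

text \<open>The differential equation solved for the second derivative, using
  \<open>(r\<^sup>2) powr ((q - 2) / 2) = u / r\<^sup>2\<close>.\<close>

lemma dh_deriv: "(deriv h has_real_derivative (r t)\<^sup>2 / (h t * u t) - h t) (at t)"
proof -
  have "(deriv h has_real_derivative deriv (deriv h) t) (at t)"
    using solution by (auto simp: solutions_def C2_def differentiable_on_def
      DERIV_deriv_iff_real_differentiable)
  moreover have "deriv (deriv h) t = (r t)\<^sup>2 / (h t * u t) - h t"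
  proof -
    have "(r t)\<^sup>2 = r t powr 2" using r_pos[of t] by simp
    then have "((r t)\<^sup>2) powr ((q - 2) / 2) = r t powr (2 * ((q - 2) / 2))" by (simp only: powr_powr)
    also have "\<dots> = r t powr (q - 2)" by (rule arg_cong[where f = "\<lambda>x. r t powr x"]) simp
    also have "\<dots> = u t / (r t)\<^sup>2" using r_pos[of t] by (simp add: powr_diff u_def)
    finally have eq: "((r t)\<^sup>2) powr ((q - 2) / 2) = u t / (r t)\<^sup>2" .
    have "h t * ((r t)\<^sup>2) powr ((q - 2) / 2) * (deriv (deriv h) t + h t) = 1"
      using solution by (simp add: solutions_def r_sq)
    then have "h t * (u t / (r t)\<^sup>2) * (deriv (deriv h) t + h t) = 1" unfolding eq .
    then show ?thesis using h_pos[of t] r_pos[of t] u_pos[of t] by (simp add: field_simps)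
  qed
  ultimately show ?thesis by simp
qed

lemma r_deriv: "(r has_real_derivative deriv h t * r t / (h t * u t)) (at t)"
proof -
  have p: "0 < (deriv h t)\<^sup>2 + (h t)\<^sup>2" using h_pos[of t] by (simp add: add_nonneg_pos)
  have "((\<lambda>t. sqrt ((deriv h t)\<^sup>2 + (h t)\<^sup>2)) has_real_derivative
    (2 * deriv h t * ((r t)\<^sup>2 / (h t * u t) - h t) + 2 * h t * deriv h t) * (inverse (r t) / 2)) (at t)"
    using p by (auto intro!: derivative_eq_intros dh_deriv h_deriv simp: r_def)
  also have "(2 * deriv h t * ((r t)\<^sup>2 / (h t * u t) - h t) + 2 * h t * deriv h t) * (inverse (r t) / 2)
     = deriv h t * r t / (h t * u t)"
    using r_pos[of t] by (simp add: power2_eq_square field_simps)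
  finally show ?thesis by (simp only: r_def[abs_def])
qed

lemma u_deriv: "(u has_real_derivative q * deriv h t / h t) (at t)"
proof -
  have "((\<lambda>t. r t powr q) has_real_derivative
     q * r t powr (q - 1) * (deriv h t * r t / (h t * u t))) (at t)"
    by (rule DERIV_cong[OF DERIV_fun_powr[OF r_deriv r_pos]]) simp
  also have "r t powr (q - 1) = u t / r t" using r_pos[of t] by (simp add: powr_diff u_def)
  also have "q * (u t / r t) * (deriv h t * r t / (h t * u t)) = q * deriv h t / h t"
    using r_pos[of t] u_pos[of t] by simp
  finally show ?thesis by (simp only: u_def[abs_def])
qed

text \<open>By \<open>u_deriv\<close> both terms have derivative \<open>h' / h\<close>. Subtracting
  \<open>1\<close> from \<open>u\<close> makes the constant \<open>0\<close> for the constant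
  solution.\<close>

lemma energy: "ln (h t) - (u t - 1) / q = ln (h 0) - (u 0 - 1) / q"
proof -
  have "((\<lambda>t. ln (h t) - (u t - 1) / q) has_real_derivative 0) (at t)" for t
    using h_pos[of t] q_pos by (auto intro!: derivative_eq_intros h_deriv u_deriv)
  then show ?thesis using DERIV_isconst_all[of "\<lambda>t. ln (h t) - (u t - 1) / q" t 0] by blast
qed

definition C :: real where "C = exp (ln (h 0) - (u 0 - 1) / q)"

definition S :: real where "S = sqrt (1 - C\<^sup>2)"

text \<open>\<open>X\<close> is \<open>sin \<phi>\<close> and \<open>K\<close> is
  \<open>cos \<phi>\<close>; \<open>(X, Y)\<close> is the point that runs through the circle of
  radius \<open>S\<close>.\<close>

definition X :: "real \<Rightarrow> real" where "X t = deriv h t / r t"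
definition K :: "real \<Rightarrow> real" where "K t = h t / r t"
definition Y :: "real \<Rightarrow> real" where "Y t = K t * gam q (u t)"

lemma K_pos: "0 < K t" using h_pos r_pos by (simp add: K_def)

lemma X_K: "(X t)\<^sup>2 + (K t)\<^sup>2 = 1"
  unfolding X_def K_def power_divide add_divide_distrib[symmetric] r_sq[symmetric]
  using r_pos[of t] by simp

lemma C_eq: "C = K t * exp (- (defect (u t) / q))"
proof -
  have "ln (u t) = q * ln (r t)" using r_pos[of t] by (simp add: u_def ln_powr)
  then have "ln (h t) - (u t - 1) / q = ln (K t) - defect (u t) / q"
    using h_pos[of t] r_pos[of t] q_pos by (simp add: K_def ln_div defect_def field_simps)
  then have "C = exp (ln (K t) - defect (u t) / q)" by (simp add: C_def energy[of t])
  then show ?thesis using K_pos[of t] by (simp add: exp_diff exp_minus divide_inverse)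
qed

lemma X_Y: "(X t)\<^sup>2 + (Y t)\<^sup>2 = 1 - C\<^sup>2"
proof -
  have "(exp (- (defect (u t) / q)))\<^sup>2 = exp (- (2 * defect (u t) / q))"
    by (simp flip: exp_double)
  then have "C\<^sup>2 = (K t)\<^sup>2 * exp (- (2 * defect (u t) / q))"
    by (simp add: C_eq[of t] power_mult_distrib)
  moreover have "(Y t)\<^sup>2 = (K t)\<^sup>2 - (K t)\<^sup>2 * exp (- (2 * defect (u t) / q))"
    by (simp add: Y_def power_mult_distrib gam_sq[OF q_pos u_pos] right_diff_distrib)
  ultimately show ?thesis using X_K[of t] by simp
qed

text \<open>The root is that of a nonnegative number because \<open>1 - C\<^sup>2\<close> is a sum
  of squares, and \<open>S < 1\<close> because \<open>C\<close> is an exponential.\<close>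

lemma S_bounds: "0 \<le> S" "S < 1" and S_sq: "S\<^sup>2 = 1 - C\<^sup>2"
proof -
  have "0 \<le> 1 - C\<^sup>2" using X_Y[of 0] by (metis add_nonneg_nonneg zero_le_power2)
  then show "0 \<le> S" "S < 1" "S\<^sup>2 = 1 - C\<^sup>2" by (auto simp: S_def C_def)
qed

lemma X_deriv: "(X has_real_derivative - Y t * (1 / rho q (u t))) (at t)"
proof -
  have "((\<lambda>t. deriv h t / r t) has_real_derivative
     (((r t)\<^sup>2 / (h t * u t) - h t) * r t - deriv h t * (deriv h t * r t / (h t * u t))) / (r t * r t)) (at t)"
    using r_pos[of t] by (auto intro!: derivative_eq_intros dh_deriv r_deriv)
  also have "(((r t)\<^sup>2 / (h t * u t) - h t) * r t - deriv h t * (deriv h t * r t / (h t * u t))) / (r t * r t)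
     = ((r t)\<^sup>2 - (deriv h t)\<^sup>2) / (h t * u t * r t) - K t"
    using r_pos[of t] h_pos[of t] u_pos[of t] by (simp add: K_def power2_eq_square field_simps)
  also have "(r t)\<^sup>2 - (deriv h t)\<^sup>2 = (h t)\<^sup>2" by (simp add: r_sq)
  also have "(h t)\<^sup>2 / (h t * u t * r t) - K t = - K t * (1 - 1 / u t)"
    using r_pos[of t] h_pos[of t] u_pos[of t] by (simp add: K_def power2_eq_square field_simps)
  also have "\<dots> = - Y t * (1 / rho q (u t))" by (simp add: Y_def flip: rho_gam[OF q_pos u_pos])
  finally show ?thesis by (simp only: X_def[abs_def])
qed

lemma K_deriv: "(K has_real_derivative X t * (1 - 1 / u t)) (at t)"
proof -
  have "((\<lambda>t. h t / r t) has_real_derivative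
     (deriv h t * r t - h t * (deriv h t * r t / (h t * u t))) / (r t * r t)) (at t)"
    using r_pos[of t] by (auto intro!: derivative_eq_intros h_deriv r_deriv)
  also have "(deriv h t * r t - h t * (deriv h t * r t / (h t * u t))) / (r t * r t) = X t * (1 - 1 / u t)"
    using r_pos[of t] h_pos[of t] u_pos[of t] by (simp add: X_def power2_eq_square field_simps)
  finally show ?thesis by (simp only: K_def[abs_def])
qed

text \<open>By \<open>rho_gam\<close> the product rule yields
  \<open>X gam\<^sup>2 / rho + X (1 - gam\<^sup>2) / rho\<close>, in which \<open>gam\<close>
  cancels.\<close>

lemma Y_deriv: "(Y has_real_derivative X t * (1 / rho q (u t))) (at t)"
proof -
  let ?g = "gam q (u t)" and ?\<rho> = "rho q (u t)"
  have \<rho>: "0 < ?\<rho>" by (rule rho_pos[OF q_pos u_pos])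
  have "(Y has_real_derivative
     X t * (1 - 1 / u t) * ?g + (1 - ?g\<^sup>2) / (q * ?\<rho>) * (q * deriv h t / h t) * K t) (at t)"
    unfolding Y_def[abs_def]
    by (rule DERIV_mult[OF K_deriv DERIV_chain2[OF gam_deriv[OF q_pos u_pos] u_deriv]])
  also have "(1 - ?g\<^sup>2) / (q * ?\<rho>) * (q * deriv h t / h t) * K t = X t * (1 - ?g\<^sup>2) / ?\<rho>"
    using q_pos h_pos[of t] by (simp add: K_def X_def mult_ac)
  also have "1 - 1 / u t = ?g / ?\<rho>" by (rule rho_gam[OF q_pos u_pos, symmetric])
  also have "X t * (?g / ?\<rho>) * ?g + X t * (1 - ?g\<^sup>2) / ?\<rho> = X t * (1 / ?\<rho>)"
    using \<rho> by (simp add: field_simps power2_eq_square)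
  finally show ?thesis .
qed

text \<open>The lift of \<open>(X, Y)\<close> to an angle determines \<open>K\<close>, then
  \<open>gam q (u t)\<close>, then \<open>u\<close>, hence \<open>h\<close>. Periodicity of
  \<open>h\<close> passes to sine and cosine only: the angle itself may gain a multiple of
  \<open>2 * pi\<close>.\<close>

lemma ex_orbit:
  assumes "0 < S"
  obtains \<tau> where "\<And>t. (\<tau> has_real_derivative 1 / rate q S (\<tau> t)) (at t)"
    "\<And>t. h t = orbit q S (\<tau> t)"
    "\<And>t. cos (\<tau> (t + 2 * pi)) = cos (\<tau> t)" "\<And>t. sin (\<tau> (t + 2 * pi)) = sin (\<tau> t)"
proof -
  have "isCont (\<lambda>t. 1 / rho q (u t)) t" for t
    using rho_pos[OF q_pos u_pos, of t] DERIV_isCont[OF u_deriv]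
    by (intro continuous_intros isCont_o2[of t u "rho q"] rho_isCont[OF q_pos u_pos]) auto
  moreover have "(X 0)\<^sup>2 + (Y 0)\<^sup>2 = S\<^sup>2" by (simp add: X_Y S_sq)
  ultimately obtain \<tau> where \<tau>: "\<And>t. (\<tau> has_real_derivative 1 / rho q (u t)) (at t)"
    "\<And>t. X t = S * cos (\<tau> t)" "\<And>t. Y t = S * sin (\<tau> t)"
    using rotation_lift[OF X_deriv Y_deriv _ assms] by blast
  have K2: "(K t)\<^sup>2 = (kap S (\<tau> t))\<^sup>2" for t
    using X_K[of t] \<tau>(2)[of t] by (simp add: kap_sq[OF S_bounds] power_mult_distrib)
  have K: "K t = kap S (\<tau> t)" for t
    by (rule power2_eq_imp_eq[OF K2]) (simp_all add: less_imp_le K_pos kap_pos S_bounds)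
  have g: "gam q (u t) = Gam S (\<tau> t)" for t
    using \<tau>(3)[of t] K_pos[of t] by (simp add: Gam_def Y_def field_simps flip: K)
  have u: "u t = ginv q (Gam S (\<tau> t))" for t
    using ginv_gam[OF q_pos u_pos, of t] by (simp add: g)
  have "u t powr (1 / q) = r t" for t
    using r_pos[of t] q_pos by (simp add: u_def powr_powr)
  then have h: "h t = orbit q S (\<tau> t)" for t
    using r_pos[of t] by (simp add: orbit_def u[symmetric] K[symmetric]) (simp add: K_def)
  have dp: "deriv h (t + 2 * pi) = deriv h t" for t
  proof -
    have "((\<lambda>t. h (t + 2 * pi)) has_real_derivative deriv h (t + 2 * pi)) (at t)"
      using h_deriv[of "t + 2 * pi"] unfolding DERIV_shift .
    then show ?thesis using h_deriv[of t] by (simp add: h_periodic DERIV_unique)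
  qed
  have rp: "r (t + 2 * pi) = r t" for t by (simp add: r_def dp h_periodic)
  have "X (t + 2 * pi) = X t" "Y (t + 2 * pi) = Y t" for t
    by (simp_all add: X_def Y_def K_def u_def rp dp h_periodic)
  then have per: "cos (\<tau> (t + 2 * pi)) = cos (\<tau> t)" "sin (\<tau> (t + 2 * pi)) = sin (\<tau> t)" for t
    using \<tau>(2,3) assms by (metis less_irrefl mult_left_cancel)+
  have "(\<tau> has_real_derivative 1 / rate q S (\<tau> t)) (at t)" for t
    using \<tau>(1)[of t] by (simp add: u rate_def)
  from that[OF this h per] show ?thesis .
qed

text \<open>The circle degenerates to the point \<open>X = Y = 0\<close>, so \<open>K = 1\<close>
  and \<open>u = 1\<close>.\<close>

lemma constant_if_S_0: assumes "S = 0" shows "h = (\<lambda>_. 1)"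
proof
  fix t
  have "0 < C" "C\<^sup>2 = 1" using S_sq assms by (simp_all add: C_def)
  then have "C = 1" by (simp add: power2_eq_1_iff)
  then have "(X t)\<^sup>2 + (Y t)\<^sup>2 = 0" using X_Y[of t] by simp
  then have X: "X t = 0" and Y: "Y t = 0" by auto
  have K: "K t = 1" using X_K[of t] X K_pos[of t] by (simp add: power2_eq_1_iff)
  have "gam q (u t) = gam q 1" using Y K by (simp add: Y_def gam_1[OF q_pos])
  then have "u t = 1" using gam_inj[OF q_pos u_pos] by simp
  then have "r t powr q = 1" by (simp add: u_def)
  then have "ln (r t powr q) = 0" by simp
  then have "r t = 1" using r_pos[of t] q_pos by (simp add: ln_powr)
  then show "h t = 1" using K by (simp add: K_def)
qed

text \<open>In time \<open>2 * pi\<close> the angle gains \<open>n\<close> full turns, so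
  \<open>n\<close> periods make \<open>2 * pi\<close>. The angle increases, whence
  \<open>n \<ge> 1\<close>, and the period exceeds \<open>pi\<close>, whence
  \<open>n < 2\<close>.\<close>

lemma cases_orbit:
  assumes "q \<le> 4" "h \<noteq> (\<lambda>_. 1)"
  obtains S \<tau> where "0 < S" "S < 1" "period q S = 2 * pi"
    "\<And>t. (\<tau> has_real_derivative 1 / rate q S (\<tau> t)) (at t)" "\<And>t. h t = orbit q S (\<tau> t)"
proof -
  have S: "0 < S" using S_bounds(1) constant_if_S_0 assms(2) by fastforce
  obtain \<tau> where \<tau>: "\<And>t. (\<tau> has_real_derivative 1 / rate q S (\<tau> t)) (at t)"
    "\<And>t. h t = orbit q S (\<tau> t)"
    "\<And>t. cos (\<tau> (t + 2 * pi)) = cos (\<tau> t)" "\<And>t. sin (\<tau> (t + 2 * pi)) = sin (\<tau> t)"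
    using ex_orbit[OF S] by metis
  note rate_pos = rate_pos[OF q_pos S_bounds]
  obtain F where F: "\<And>t. (F has_real_derivative rate q S t) (at t)"
    "\<And>t. F (t + 2 * pi) = F t + period q S"
    using ex_clock[OF q_pos S_bounds] by metis
  \<comment> \<open>The clock \<open>F\<close> turns the angle back into time.\<close>
  have "((\<lambda>t. F (\<tau> t) - t) has_real_derivative 0) (at t)" for t
    using rate_pos[of "\<tau> t"] by (auto intro!: derivative_eq_intros DERIV_chain2[OF F(1) \<tau>(1)])
  then have "F (\<tau> (2 * pi)) - 2 * pi = F (\<tau> 0) - 0"
    using DERIV_isconst_all[of "\<lambda>t. F (\<tau> t) - t" "2 * pi" 0] by blast
  then have 1: "F (\<tau> (2 * pi)) = F (\<tau> 0) + 2 * pi" by simp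
  have "sin (\<tau> (2 * pi)) = sin (\<tau> 0) \<and> cos (\<tau> (2 * pi)) = cos (\<tau> 0)"
    using \<tau>(3,4)[of 0] by simp
  then obtain n :: int where n: "\<tau> (2 * pi) = \<tau> 0 + 2 * pi * n" by (auto simp: sin_cos_eq_iff)
  have "\<tau> 0 < \<tau> (2 * pi)"
    by (rule DERIV_pos_imp_increasing) (auto intro!: exI \<tau>(1) rate_pos)
  then have n0: "0 < n" unfolding n by (simp add: zero_less_mult_iff)
  have "F (s + 2 * pi * real m) = F s + real m * period q S" for s m
  proof (induction m)
    case (Suc m)
    have "s + 2 * pi * real (Suc m) = (s + 2 * pi * real m) + 2 * pi" by (simp add: algebra_simps)
    then show ?case using Suc by (simp only: F(2)) (simp add: algebra_simps)
  qed simp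
  from this[of "\<tau> 0" "nat n"] have 2: "n * period q S = 2 * pi" using 1 n n0 by simp
  have P: "pi < period q S" using period_gt_pi[OF q_pos assms(1) S S_bounds(2)] .
  have "n < 2"
  proof (rule ccontr)
    assume "\<not> n < 2"
    then have "2 * period q S \<le> n * period q S" using less_trans[OF pi_gt_zero P] by (intro mult_right_mono) auto
    then show False using P 2 by simp
  qed
  then have "n = 1" using n0 by simp
  then have 3: "period q S = 2 * pi" using 2 by simp
  show ?thesis by (rule that[OF S S_bounds(2) 3 \<tau>(1,2)])
qed

end

text \<open>The clock \<open>F\<close>, an antiderivative of the rate, satisfies \<open>F (\<tau> t) = F (\<tau> 0) + t\<close> along both.\<close>

lemma orbit_unique:
  assumes "0 < q" "0 \<le> S" "S < 1"
    and 1: "\<And>t. (\<tau>\<^sub>1 has_real_derivative 1 / rate q S (\<tau>\<^sub>1 t)) (at t)"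
    and 2: "\<And>t. (\<tau>\<^sub>2 has_real_derivative 1 / rate q S (\<tau>\<^sub>2 t)) (at t)"
  obtains c where "\<And>t. \<tau>\<^sub>2 t = \<tau>\<^sub>1 (t + c)"
proof -
  note rate_pos = rate_pos[OF assms(1-3)]
  obtain F where F: "\<And>t. (F has_real_derivative rate q S t) (at t)"
    using ex_clock[OF assms(1-3)] by metis
  have const: "F (\<tau> t) = F (\<tau> 0) + t" if "\<And>t. (\<tau> has_real_derivative 1 / rate q S (\<tau> t)) (at t)" for \<tau> t
  proof -
    have "((\<lambda>t. F (\<tau> t) - t) has_real_derivative 0) (at t)" for t
      using rate_pos[of "\<tau> t"] by (auto intro!: derivative_eq_intros DERIV_chain2[OF F that])
    then have "F (\<tau> t) - t = F (\<tau> 0) - 0"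
      using DERIV_isconst_all[of "\<lambda>t. F (\<tau> t) - t" t 0] by blast
    then show ?thesis by simp
  qed
  have mono: "F s < F t" if "s < t" for s t
    by (rule DERIV_pos_imp_increasing[OF that]) (auto intro!: exI F rate_pos)
  have inj: "s = t" if "F s = F t" for s t
    using mono[of s t] mono[of t s] that by (cases s t rule: linorder_cases) auto
  have "\<tau>\<^sub>2 t = \<tau>\<^sub>1 (t + (F (\<tau>\<^sub>2 0) - F (\<tau>\<^sub>1 0)))" for t
    by (rule inj) (simp add: const[OF 1, of "t + _"] const[OF 2, of t])
  then show ?thesis using that by blast
qed


section \<open>Smoothness\<close>

text \<open>A solution is smooth because the algebra generated by \<open>h\<close>, \<open>h'\<close>, \<open>1 / h\<close> and \<open>1 / u\<close> is
  closed under differentiation.\<close>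

inductive gen_alg :: "(real \<Rightarrow> real) set \<Rightarrow> (real \<Rightarrow> real) \<Rightarrow> bool" for G where
  gen: "f \<in> G \<Longrightarrow> gen_alg G f"
| const: "gen_alg G (\<lambda>_. c)"
| add: "gen_alg G f \<Longrightarrow> gen_alg G g \<Longrightarrow> gen_alg G (\<lambda>t. f t + g t)"
| mult: "gen_alg G f \<Longrightarrow> gen_alg G g \<Longrightarrow> gen_alg G (\<lambda>t. f t * g t)"

lemma gen_alg_deriv:
  assumes "\<And>f. f \<in> G \<Longrightarrow> \<exists>f'. gen_alg G f' \<and> (\<forall>t. (f has_real_derivative f' t) (at t))"
    and "gen_alg G f"
  shows "\<exists>f'. gen_alg G f' \<and> (\<forall>t. (f has_real_derivative f' t) (at t))"
  using assms(2)
proof induction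
  case (const c)
  show ?case by (intro exI[of _ "\<lambda>_. 0"] conjI gen_alg.const) auto
next
  case (add f g)
  then obtain f' g' where *: "gen_alg G f'" "gen_alg G g'"
    "\<forall>t. (f has_real_derivative f' t) (at t)" "\<forall>t. (g has_real_derivative g' t) (at t)" by blast
  show ?case
    by (intro exI[of _ "\<lambda>t. f' t + g' t"] conjI gen_alg.add allI DERIV_add) (use * in auto)
next
  case (mult f g)
  then obtain f' g' where *: "gen_alg G f'" "gen_alg G g'"
    "\<forall>t. (f has_real_derivative f' t) (at t)" "\<forall>t. (g has_real_derivative g' t) (at t)" by blast
  show ?case
    by (intro exI[of _ "\<lambda>t. f' t * g t + g' t * f t"] conjI gen_alg.add gen_alg.mult allI DERIV_mult)
      (use * mult.hyps in auto)
qed (use assms(1) in blast)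

lemma gen_alg_smooth:
  assumes G: "\<And>f. f \<in> G \<Longrightarrow> \<exists>f'. gen_alg G f' \<and> (\<forall>t. (f has_real_derivative f' t) (at t))"
    and "gen_alg G f"
  shows "smooth f"
proof -
  have step: "gen_alg G (deriv g)" if "gen_alg G g" for g
  proof -
    obtain g' where "gen_alg G g'" "\<forall>t. (g has_real_derivative g' t) (at t)"
      using gen_alg_deriv[OF G \<open>gen_alg G g\<close>] by blast
    moreover from this have "deriv g = g'" using DERIV_imp_deriv by blast
    ultimately show ?thesis by simp
  qed
  have "gen_alg G ((deriv ^^ n) f)" for n
    by (induction n) (use assms(2) step in auto)
  then have "(deriv ^^ n) f differentiable_on UNIV" for n
    using gen_alg_deriv[OF G, of "(deriv ^^ n) f"]
    by (auto simp: differentiable_on_def real_differentiable_def)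
  then show ?thesis by (simp add: smooth_def)
qed

context dual_solution
begin

lemma smooth_solution: "smooth h"
proof (rule gen_alg_smooth)
  let ?z = "\<lambda>t. 1 / h t" and ?v = "\<lambda>t. 1 / u t"
  let ?G = "{h, deriv h, ?z, ?v}"
  have g: "gen_alg ?G h" "gen_alg ?G (deriv h)" "gen_alg ?G ?z" "gen_alg ?G ?v"
    by (auto intro!: gen_alg.gen)
  note gs = g gen_alg.const gen_alg.mult gen_alg.add
  show "gen_alg ?G h" by (fact g(1))
  fix f assume "f \<in> ?G"
  then consider "f = h" | "f = deriv h" | "f = ?z" | "f = ?v" by blast
  then show "\<exists>f'. gen_alg ?G f' \<and> (\<forall>t. (f has_real_derivative f' t) (at t))"
  proof cases
    case 1
    then show ?thesis using h_deriv g(2) by blast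
  next
    case 2
    \<comment> \<open>The constructors of \<open>gen_alg\<close> provide only constants, sums and
      products besides the generators, so differences are written with the factor \<open>-1\<close>
      and quotients with \<open>?z\<close> and \<open>?v\<close>.\<close>
    have "(deriv h has_real_derivative (deriv h t * deriv h t + h t * h t) * (?z t * ?v t) + (-1) * h t) (at t)" for t
      using dh_deriv[of t] unfolding r_sq by (simp add: power2_eq_square)
    then show ?thesis unfolding 2
      by (intro exI[of _ "\<lambda>t. (deriv h t * deriv h t + h t * h t) * (?z t * ?v t) + (-1) * h t"] conjI allI)
        (intro gs | assumption)+
  next
    case 3
    have "(?z has_real_derivative (-1) * (deriv h t * (?z t * ?z t))) (at t)" for t
      using h_pos[of t] by (auto intro!: derivative_eq_intros h_deriv)
    then show ?thesis unfolding 3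
      by (intro exI[of _ "\<lambda>t. (-1) * (deriv h t * (?z t * ?z t))"] conjI allI)
        (intro gs | assumption)+
  next
    case 4
    have "(?v has_real_derivative (- q) * (deriv h t * (?z t * (?v t * ?v t)))) (at t)" for t
      using h_pos[of t] u_pos[of t] by (auto intro!: derivative_eq_intros u_deriv)
    then show ?thesis unfolding 4
      by (intro exI[of _ "\<lambda>t. (- q) * (deriv h t * (?z t * (?v t * ?v t)))"] conjI allI)
        (intro gs | assumption)+
  qed
qed

end

section \<open>Orbits of period \<open>2\<pi>\<close> are solutions\<close>

context
  fixes q S :: real
  assumes q_pos: "0 < q" and S: "0 \<le> S" "S < 1"
begin

text \<open>The clock is increasing and adds \<open>2 * pi\<close> per turn, so it is a bijection of
  the line; its inverse gives the angle at a given time.\<close>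

lemma inverse_clock:
  assumes T: "period q S = 2 * pi"
  obtains \<tau> where "\<And>t. (\<tau> has_real_derivative 1 / rate q S (\<tau> t)) (at t)"
    "\<And>t. \<tau> (t + 2 * pi) = \<tau> t + 2 * pi" "surj \<tau>"
proof -
  note rate_pos = rate_pos[OF q_pos S]
  obtain F where F: "\<And>t. (F has_real_derivative rate q S t) (at t)"
    "\<And>t. F (t + 2 * pi) = F t + 2 * pi"
    using ex_clock[OF q_pos S] T by metis
  have mono: "F s < F t" if "s < t" for s t
    by (rule DERIV_pos_imp_increasing[OF that]) (auto intro!: exI F(1) rate_pos)
  have inj: "inj F"
  proof (rule injI)
    fix s t assume "F s = F t"
    then show "s = t" using mono[of s t] mono[of t s] by (cases s t rule: linorder_cases) auto
  qed
  have cont: "isCont F t" for t using F(1) DERIV_isCont by blast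
  have iter: "F (s + 2 * pi * real n) = F s + 2 * pi * real n" for s n
  proof (induction n)
    case (Suc n)
    have "s + 2 * pi * real (Suc n) = (s + 2 * pi * real n) + 2 * pi" by (simp add: algebra_simps)
    then have "F (s + 2 * pi * real (Suc n)) = F (s + 2 * pi * real n) + 2 * pi" by (simp only: F(2))
    also have "\<dots> = F s + 2 * pi * real (Suc n)" unfolding Suc by (simp add: distrib_left)
    finally show ?case .
  qed simp
  have surj: "\<exists>s. F s = y" for y
  proof -
    \<comment> \<open>Enough turns in both directions place \<open>y\<close> between two values of
      \<open>F\<close>.\<close>
    obtain n :: nat where n: "\<bar>y - F 0\<bar> < real n * (2 * pi)"
      using reals_Archimedean3[of "2 * pi"] by auto
    have "F (0 + 2 * pi * real n) = F 0 + 2 * pi * real n" by (rule iter)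
    moreover have "F (- (2 * pi * real n) + 2 * pi * real n) = F (- (2 * pi * real n)) + 2 * pi * real n"
      by (rule iter)
    ultimately have "F (- (2 * pi * real n)) \<le> y" "y \<le> F (2 * pi * real n)"
      using n by (auto simp: abs_less_iff algebra_simps)
    then show ?thesis
      using IVT[of F "- (2 * pi * real n)" y "2 * pi * real n"] cont by auto
  qed
  define \<tau> where "\<tau> = inv F"
  have F\<tau>: "F (\<tau> y) = y" for y using surj[of y] by (auto simp: \<tau>_def intro: f_inv_into_f)
  have \<tau>F: "\<tau> (F s) = s" for s using inj by (simp add: \<tau>_def)
  have "isCont \<tau> (F s)" for s
    by (rule isCont_inverse_function[where f = F and d = 1]) (auto simp: \<tau>F cont)
  then have \<tau>cont: "isCont \<tau> t" for t by (metis F\<tau>)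
  have 1: "(\<tau> has_real_derivative 1 / rate q S (\<tau> t)) (at t)" for t
  proof -
    have "(\<tau> has_real_derivative inverse (rate q S (\<tau> t))) (at t)"
      by (rule DERIV_inverse_function[where f = F and a = "t - 1" and b = "t + 1"])
        (use F(1) F\<tau> \<tau>cont rate_pos[of "\<tau> t"] in auto)
    then show ?thesis by (simp add: inverse_eq_divide)
  qed
  have 2: "\<tau> (t + 2 * pi) = \<tau> t + 2 * pi" for t
    using \<tau>F[of "\<tau> t + 2 * pi"] by (simp add: F(2) F\<tau>)
  have 3: "surj \<tau>" using \<tau>F by (metis surjI)
  show ?thesis by (rule that[OF 1 2 3])
qed

context
  fixes \<tau> :: "real \<Rightarrow> real"
  assumes \<tau>: "\<And>t. (\<tau> has_real_derivative 1 / rate q S (\<tau> t)) (at t)"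
begin

text \<open>For the converse direction, \<open>cos \<phi>\<close>, \<open>u\<close>,
  \<open>r\<close> and \<open>sin \<phi>\<close> are now defined from the angle, and their
  derivatives recover the original equation.\<close>

private definition "K t = kap S (\<tau> t)"
private definition "U t = ginv q (Gam S (\<tau> t))"
private definition "R t = U t powr (1 / q)"
private definition "X t = S * cos (\<tau> t)"

private lemma K_pos: "0 < K t" unfolding K_def by (rule kap_pos[OF S])
private lemma U_pos: "0 < U t" unfolding U_def by (intro gam_ginv(1) q_pos Gam_abs_less S)
private lemma gam_U: "gam q (U t) = Gam S (\<tau> t)" unfolding U_def by (intro gam_ginv(2) q_pos Gam_abs_less S)
private lemma R_pos: "0 < R t" using U_pos[of t] by (simp add: R_def)
private lemma rate_U: "rate q S (\<tau> t) = rho q (U t)" by (simp add: rate_def U_def)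
private lemma rho_U_pos: "0 < rho q (U t)" by (rule rho_pos[OF q_pos U_pos])

private lemma X_K: "(X t)\<^sup>2 + (K t)\<^sup>2 = 1"
  by (simp add: X_def K_def kap_sq[OF S] power_mult_distrib)

private lemma sin_eq: "S * sin (\<tau> t) / rho q (U t) = K t * (1 - 1 / U t)"
  using K_pos[of t] unfolding rho_gam[OF q_pos U_pos, symmetric] gam_U
  by (simp add: Gam_def K_def)

private lemma X_deriv: "(X has_real_derivative - K t * (1 - 1 / U t)) (at t)"
proof -
  have "(X has_real_derivative - (S * sin (\<tau> t) / rho q (U t))) (at t)"
    unfolding X_def[abs_def] by (auto intro!: derivative_eq_intros \<tau> simp: rate_U)
  then show ?thesis by (simp add: sin_eq)
qed

private lemma K_deriv: "(K has_real_derivative X t * (1 - 1 / U t)) (at t)"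
proof -
  have "(K has_real_derivative (S\<^sup>2 * cos (\<tau> t) * sin (\<tau> t) / K t) * (1 / rho q (U t))) (at t)"
    unfolding K_def[abs_def] rate_U[symmetric] by (rule DERIV_chain2[OF kap_deriv[OF S] \<tau>])
  also have "(S\<^sup>2 * cos (\<tau> t) * sin (\<tau> t) / K t) * (1 / rho q (U t)) = X t / K t * (S * sin (\<tau> t) / rho q (U t))"
    by (simp add: X_def power2_eq_square)
  also have "\<dots> = X t * (1 - 1 / U t)" using K_pos[of t] by (simp add: sin_eq)
  finally show ?thesis .
qed

private lemma U_deriv: "(U has_real_derivative q * X t / K t) (at t)"
proof -
  let ?y = "Gam S (\<tau> t)"
  have y: "1 - ?y\<^sup>2 \<noteq> 0" using Gam_abs_less[OF S, of "\<tau> t"] by (auto simp: abs_square_less_1[symmetric])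
  have "(U has_real_derivative q * rho q (U t) / (1 - ?y\<^sup>2) *
    (S * cos (\<tau> t) * (1 - ?y\<^sup>2) / K t * (1 / rho q (U t)))) (at t)"
    unfolding U_def[abs_def] K_def rate_def[symmetric]
    by (intro DERIV_chain2[OF _ DERIV_chain2[OF Gam_deriv[OF S] \<tau>]]
       DERIV_cong[OF ginv_deriv[OF q_pos Gam_abs_less[OF S]]]) (simp add: rate_def)
  also have "q * rho q (U t) / (1 - ?y\<^sup>2) *
    (S * cos (\<tau> t) * (1 - ?y\<^sup>2) / K t * (1 / rho q (U t))) = q * X t / K t"
    using y rho_U_pos[of t] by (simp add: X_def)
  finally show ?thesis .
qed

private lemma R_deriv: "(R has_real_derivative R t * X t / (U t * K t)) (at t)"
proof -
  have "(R has_real_derivative (1 / q) * U t powr (1 / q - 1) * (q * X t / K t)) (at t)"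
    unfolding R_def[abs_def] by (rule DERIV_cong[OF DERIV_fun_powr[OF U_deriv U_pos]]) simp
  also have "U t powr (1 / q - 1) = R t / U t" using U_pos[of t] by (simp add: powr_diff R_def)
  also have "(1 / q) * (R t / U t) * (q * X t / K t) = R t * X t / (U t * K t)"
    using q_pos by simp
  finally show ?thesis .
qed

private lemma h_deriv: "((\<lambda>t. R t * K t) has_real_derivative R t * X t) (at t)"
  by (rule DERIV_cong[OF DERIV_mult[OF R_deriv K_deriv]])
    (use K_pos[of t] U_pos[of t] in \<open>simp add: field_simps\<close>)

private lemma dh_deriv: "((\<lambda>t. R t * X t) has_real_derivative R t / (U t * K t) - R t * K t) (at t)"
proof (rule DERIV_cong[OF DERIV_mult[OF R_deriv X_deriv]])
  have "R t * X t / (U t * K t) * X t + - K t * (1 - 1 / U t) * R t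
    = R t * ((X t)\<^sup>2 + (K t)\<^sup>2) / (U t * K t) - R t * K t"
    using K_pos[of t] U_pos[of t] by (simp add: power2_eq_square field_simps)
  then show "R t * X t / (U t * K t) * X t + - K t * (1 - 1 / U t) * R t = R t / (U t * K t) - R t * K t"
    by (simp add: X_K)
qed

text \<open>For \<open>h = R K\<close> one has \<open>h' = R X\<close>, so
  \<open>h\<^sup>2 + h'\<^sup>2 = R\<^sup>2\<close>, and \<open>h'' + h = R / (U K)\<close>. The
  left side of the equation becomes \<open>R powr q / U = 1\<close>.\<close>

lemma orbit_solution:
  assumes per: "\<And>t. \<tau> (t + 2 * pi) = \<tau> t + 2 * pi"
  shows "(\<lambda>t. orbit q S (\<tau> t)) \<in> solutions q"
proof -
  let ?h = "\<lambda>t. R t * K t"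
  have h: "(\<lambda>t. orbit q S (\<tau> t)) = ?h" by (simp add: orbit_def R_def U_def K_def)
  have d1: "deriv ?h = (\<lambda>t. R t * X t)" using DERIV_imp_deriv[OF h_deriv] by blast
  have d2: "deriv (deriv ?h) = (\<lambda>t. R t / (U t * K t) - R t * K t)"
    unfolding d1 using DERIV_imp_deriv[OF dh_deriv] by blast
  have "?h \<in> solutions q"
    unfolding solutions_def mem_Collect_eq d2
  proof (intro conjI allI)
    fix t
    show "R (t + 2 * pi) * K (t + 2 * pi) = R t * K t"
      by (simp add: R_def U_def K_def per Gam_add_2pi) (simp add: kap_def)
    show "0 < R t * K t" using R_pos K_pos by simp
    have "(deriv ?h t)\<^sup>2 + (R t * K t)\<^sup>2 = (R t)\<^sup>2 * ((X t)\<^sup>2 + (K t)\<^sup>2)"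
      unfolding d1 by (simp add: power_mult_distrib distrib_left)
    also have "\<dots> = R t powr 2" using R_pos[of t] by (simp add: X_K)
    finally have "((deriv ?h t)\<^sup>2 + (R t * K t)\<^sup>2) powr ((q - 2) / 2) = R t powr (2 * ((q - 2) / 2))"
      by (simp only: powr_powr)
    also have "\<dots> = R t powr (q - 2)" by (rule arg_cong[where f = "\<lambda>x. R t powr x"]) simp
    also have "\<dots> = R t powr q / (R t)\<^sup>2" using R_pos[of t] by (simp add: powr_diff)
    also have "R t powr q = U t" using q_pos U_pos[of t] by (simp add: R_def powr_powr)
    finally have "((deriv ?h t)\<^sup>2 + (R t * K t)\<^sup>2) powr ((q - 2) / 2) = U t / (R t)\<^sup>2" .
    then show "R t * K t * ((deriv ?h t)\<^sup>2 + (R t * K t)\<^sup>2) powr ((q - 2) / 2) *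
        (R t / (U t * K t) - R t * K t + R t * K t) = 1"
      using R_pos[of t] K_pos[of t] U_pos[of t] by (simp add: power2_eq_square)
  next
    have "isCont R t" "isCont U t" "isCont K t" for t
      using R_deriv U_deriv K_deriv DERIV_isCont by blast+
    then have c: "isCont (\<lambda>t. R t / (U t * K t) - R t * K t) t" for t
      using U_pos[of t] K_pos[of t] by (intro continuous_intros) auto
    show "C2 ?h" unfolding C2_def d2 unfolding d1
      using h_deriv dh_deriv c
      by (auto simp: differentiable_on_def real_differentiable_def intro: continuous_at_imp_continuous_on)
  qed
  then show ?thesis by (simp only: h)
qed

end
end

text \<open>At the angles \<open>\<plusminus> pi / 2\<close> the factor \<open>kap\<close> is
  \<open>1\<close> while \<open>Gam\<close> is \<open>\<plusminus> S\<close>, so the two values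
  differ; surjectivity of \<open>\<tau>\<close> makes both angles occur.\<close>

lemma orbit_nonconstant:
  assumes "0 < q" "0 < S" "S < 1" "surj \<tau>"
  shows "\<not> (\<lambda>t. orbit q S (\<tau> t)) constant_on UNIV"
proof
  assume "(\<lambda>t. orbit q S (\<tau> t)) constant_on UNIV"
  then obtain c where "\<And>t. orbit q S (\<tau> t) = c" by (auto simp: constant_on_def)
  then have "orbit q S s = c" for s using assms(4) by (metis surjD)
  then have "orbit q S (pi / 2) = orbit q S (- (pi / 2))" by simp
  moreover have "Gam S (pi / 2) = S" "Gam S (- (pi / 2)) = - S" "kap S (pi / 2) = 1" "kap S (- (pi / 2)) = 1"
    by (auto simp: Gam_def kap_def)
  moreover have "ginv q (- S) < ginv q S" "0 < ginv q (- S)"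
    using assms by (auto intro!: ginv_strict_mono gam_ginv)
  ultimately show False
    using powr_less_mono2[of "1 / q" "ginv q (- S)" "ginv q S"] assms by (simp add: orbit_def)
qed

section \<open>Counting the solutions up to rotation\<close>

lemma one_solution: "(\<lambda>\<theta>. 1) \<in> solutions q"
  by (auto simp: solutions_def C2_def)

theorem theorem1p1:
  fixes q :: real
  shows "(0 < q \<and> q < 1 \<longrightarrow>
           card (solutions q // rotation) = 2 \<and>
           (\<lambda>\<theta>. 1) \<in> solutions q \<and>
           (\<exists>h \<in> solutions q. smooth h \<and> \<not> h constant_on UNIV \<and>
              solutions q // rotation = {rotation `` {\<lambda>\<theta>. 1}, rotation `` {h}})) \<and>
         (1 \<le> q \<and> q \<le> 4 \<longrightarrow> solutions q = {\<lambda>\<theta>. 1})"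
proof (intro conjI impI; elim conjE)
  assume q: "1 \<le> q" "q \<le> 4"
  have "h = (\<lambda>_. 1)" if "h \<in> solutions q" for h
  proof (rule ccontr)
    assume h: "h \<noteq> (\<lambda>_. 1)"
    interpret dual_solution q h using q that by unfold_locales auto
    obtain S where S: "0 < S" "S < 1" "period q S = 2 * pi" using cases_orbit[OF q(2) h] .
    then show False using period_less_2pi[OF q_pos q(1) S(1,2)] by simp
  qed
  then show "solutions q = {\<lambda>\<theta>. 1}" using one_solution by blast
next
  assume q: "0 < q" "q < 1"
  obtain S where S: "0 < S" "S < 1" "period q S = 2 * pi" using ex_period_eq_2pi[OF q] .
  have S0: "0 \<le> S" using S by simp
  obtain \<tau> where \<tau>: "\<And>t. (\<tau> has_real_derivative 1 / rate q S (\<tau> t)) (at t)"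
    "\<And>t. \<tau> (t + 2 * pi) = \<tau> t + 2 * pi" "surj \<tau>"
    using inverse_clock[OF q(1) S0 S(2,3)] by metis
  define h where "h = (\<lambda>t. orbit q S (\<tau> t))"
  have h: "h \<in> solutions q" unfolding h_def by (rule orbit_solution[OF q(1) S0 S(2) \<tau>(1,2)])
  have nc: "\<not> h constant_on UNIV" unfolding h_def by (rule orbit_nonconstant[OF q(1) S(1,2) \<tau>(3)])
  have sm: "smooth h"
  proof -
    interpret dual_solution q h using q h by unfold_locales auto
    show ?thesis by (rule smooth_solution)
  qed
  have rot: "(h, g) \<in> rotation" if g: "g \<in> solutions q" "g \<noteq> (\<lambda>_. 1)" for g
  proof -
    interpret dual_solution q g using q g by unfold_locales auto
    have q4: "q \<le> 4" using q by simp
    obtain R \<sigma> where R: "0 < R" "R < 1" "period q R = 2 * pi"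
      "\<And>t. (\<sigma> has_real_derivative 1 / rate q R (\<sigma> t)) (at t)" "\<And>t. g t = orbit q R (\<sigma> t)"
      using cases_orbit[OF q4 g(2)] by metis
    \<comment> \<open>The period is strictly decreasing in the radius, so equal periods mean equal
      radii. Orbits of the same radius differ by a shift of time, which is a rotation.\<close>
    have "R = S"
      using period_strict_antimono[OF q(1) _ R(1), of S] period_strict_antimono[OF q(1) _ S(1), of R] S R q
      by (cases R S rule: linorder_cases) auto
    then obtain c where "\<And>t. \<sigma> t = \<tau> (t + c)"
      using orbit_unique[OF q(1) S0 S(2) \<tau>(1), of \<sigma>] R(4) by metis
    then show ?thesis using R(5) \<open>R = S\<close> by (auto simp: rotation_def h_def)
  qed
  have Q: "solutions q // rotation = {rotation `` {\<lambda>\<theta>. 1}, rotation `` {h}}"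
  proof -
    have "rotation `` {g} = rotation `` {h}" if "g \<in> solutions q" "g \<noteq> (\<lambda>_. 1)" for g
      using equiv_class_eq[OF equiv_rotation rot[OF that]] by simp
    then show ?thesis using h one_solution[of q] unfolding quotient_def by blast
  qed
  \<comment> \<open>Every rotation of a constant function is constant.\<close>
  have "rotation `` {\<lambda>\<theta>. 1} \<noteq> rotation `` {h}"
  proof
    assume "rotation `` {\<lambda>\<theta>. 1} = rotation `` {h}"
    then have "((\<lambda>\<theta>. 1), h) \<in> rotation" using eq_equiv_class[OF _ equiv_rotation] by blast
    then show False using nc by (auto simp: rotation_def constant_on_def)
  qed
  then show "card (solutions q // rotation) = 2" unfolding Q by simp
  show "(\<lambda>\<theta>. 1) \<in> solutions q" by (rule one_solution)
  show "\<exists>h \<in> solutions q. smooth h \<and> \<not> h constant_on UNIV \<and>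
      solutions q // rotation = {rotation `` {\<lambda>\<theta>. 1}, rotation `` {h}}"
    using h sm nc Q by blast
qed

end
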